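(* Let $G=(V,E)$ be an infinite, countable, connected, quasi-transitive graph. Consider either nearest-neighbour Bernoulli bond (edge) percolation or nearest-neighbour Bernoulli site percolation on $G$, and let $p<p_H$ (with $p\in[0,1]$). Then there is a constant $\alpha_p>0$ such that for any positive integer $n$ $$\mathbb{P}_p(|C_x|\ge n)\le e^{-\alpha_p n}\qquad\text{for any vertex } x\in V.$$
   Context: A graph $G$ is quasi-transitive if there is a finite set of vertices $\mathcal{F}$ such that every vertex $x$ can be written as $x=\gamma y$ with $y\in\mathcal{F}$ and $\gamma\in\mathrm{Aut}(G)$; equivalently, the automorphism group $\mathrm{Aut}(G)$ acts on $V$ with finitely many orbits. Bond percolation with parameter $p\in[0,1]$: each edge is independently open with probability $p$ and closed with probability $1-p$; $G(\omega)$ is the subgraph with vertex set $V$ whose edges are the open edges. Site percolation with parameter $p$: each vertex is independently open with probability $p$ and closed with probability $1-p$; $G(\omega)$ is the subgraph of $G$ induced by the open vertices. In both cases $\mathbb{P}_p$ is the corresponding product measure. The cluster $C_x(\omega)$ is the connected component of $G(\omega)$ containing $x$ (in the site model it is empty if $x$ is closed), and $|C_x|$ is its number of vertices (possibly infinite). The percolation threshold is $p_H:=\sup\{p\in[0,1]:\ \mathbb{P}_p(|C_x|=\infty)=0\}$, which does not depend on the choice of the vertex $x$.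
   Formalization: For bond percolation the bound is stated for n ≥ 2 only: at n = 1 it is false, since the bond cluster always contains x and so P_p(|C_x| ≥ 1) = 1 > e^{-α} for every α > 0; for site percolation it is stated for all n ≥ 1. *)

theory Defs
  imports "HOL-Probability.Probability" "HOL-Library.Extended_Nat"
begin

(* A graph is a vertex set V together with a set E of two-element subsets of V.  Neither V nor
   the degrees are required to be finite. *)

definition simple_graph :: "'a set \<Rightarrow> 'a set set \<Rightarrow> bool" where
  "simple_graph V E \<longleftrightarrow> (\<forall>e\<in>E. e \<subseteq> V \<and> card e = 2)"

definition graph_adj :: "'a set set \<Rightarrow> 'a rel" where
  "graph_adj E = {(u, v). {u, v} \<in> E}"

definition component :: "'a set \<Rightarrow> 'a set set \<Rightarrow> 'a \<Rightarrow> 'a set" where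
  "component V E x = {y. x \<in> V \<and> (x, y) \<in> (graph_adj E)\<^sup>*}"

definition connected_graph :: "'a set \<Rightarrow> 'a set set \<Rightarrow> bool" where
  "connected_graph V E \<longleftrightarrow> (\<forall>x\<in>V. \<forall>y\<in>V. (x, y) \<in> (graph_adj E)\<^sup>*)"

definition graph_aut :: "'a set \<Rightarrow> 'a set set \<Rightarrow> ('a \<Rightarrow> 'a) set" where
  "graph_aut V E =
     {\<gamma>. bij_betw \<gamma> V V \<and> (\<forall>u\<in>V. \<forall>v\<in>V. {\<gamma> u, \<gamma> v} \<in> E \<longleftrightarrow> {u, v} \<in> E)}"

definition quasi_transitive :: "'a set \<Rightarrow> 'a set set \<Rightarrow> bool" where
  "quasi_transitive V E \<longleftrightarrow>
     (\<exists>F. finite F \<and> F \<subseteq> V \<and> (\<forall>x\<in>V. \<exists>y\<in>F. \<exists>\<gamma>\<in>graph_aut V E. x = \<gamma> y))"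

definition cluster_size :: "'a set \<Rightarrow> enat" where
  "cluster_size C = (if finite C then enat (card C) else \<infinity>)"

(* Configurations: I is the edge set (bond model) or the vertex set (site model), and
   "\<omega> i" means that i is open. *)

definition percolation_measure :: "'i set \<Rightarrow> real \<Rightarrow> ('i \<Rightarrow> bool) measure" where
  "percolation_measure I p = PiM I (\<lambda>_. measure_pmf (bernoulli_pmf p))"

(* The bond cluster of a vertex x always contains x, so it has at least one vertex. *)
definition bond_cluster :: "'a set \<Rightarrow> 'a set set \<Rightarrow> ('a set \<Rightarrow> bool) \<Rightarrow> 'a \<Rightarrow> 'a set" where
  "bond_cluster V E \<omega> x = component V {e \<in> E. \<omega> e} x"

definition site_cluster :: "'a set \<Rightarrow> 'a set set \<Rightarrow> ('a \<Rightarrow> bool) \<Rightarrow> 'a \<Rightarrow> 'a set" where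
  "site_cluster V E \<omega> x = component {v \<in> V. \<omega> v} {e \<in> E. \<forall>v\<in>e. \<omega> v} x"

(* The thresholds are taken at a base vertex x; on a connected graph they do not depend on x. *)

definition bond_threshold :: "'a set \<Rightarrow> 'a set set \<Rightarrow> 'a \<Rightarrow> real" where
  "bond_threshold V E x =
     Sup {p \<in> {0..1}. \<P>(\<omega> in percolation_measure E p. cluster_size (bond_cluster V E \<omega> x) = \<infinity>) = 0}"

definition site_threshold :: "'a set \<Rightarrow> 'a set set \<Rightarrow> 'a \<Rightarrow> real" where
  "site_threshold V E x =
     Sup {p \<in> {0..1}. \<P>(\<omega> in percolation_measure V p. cluster_size (site_cluster V E \<omega> x) = \<infinity>) = 0}"

end

theory Submission
  imports Defs
begin

text \<open>
  Why the clusters have exponential tails. Fix \<open>p < p'\<close> such that there is no percolation at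
  \<open>p'\<close>, and tilt the law \<open>P_{p'}\<close> by the weight \<open>w ^ |C_x|\<close> with \<open>w < 1\<close>.
  Equivalently, colour every vertex green with probability \<open>1 - w\<close> and condition on the cluster
  containing no green vertex. Reveal the cluster of \<open>x\<close> one edge (or vertex) at a time. Opening
  the next item, which leads to a vertex \<open>y\<close>, adds at most the cluster of \<open>y\<close> in the
  unrevealed part. By the Harris inequality this multiplies the expected weight by at least
  \<open>E_{p'} (w ^ |C_y|)\<close>. If these expectations are all at least \<open>c\<close>, then under the tilted
  law each revealed item is open with conditional probability at least \<open>p' * c\<close>. So for
  \<open>p \<le> p' * c\<close> the tilted cluster is stochastically larger than the cluster under \<open>P_p\<close>
  (\<open>tilted_domination\<close>), and
  \<open>P_p (|C_x| \<ge> n) \<le> E_{p'} (w ^ |C_x|; |C_x| \<ge> n) / E_{p'} (w ^ |C_x|) \<le> w ^ n / c\<close>.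

  A constant \<open>c\<close> as close to 1 as desired is available for \<open>w\<close> near 1, because clusters are
  finite at \<open>p'\<close> (\<open>weight_lower_bound\<close>). Uniformity over the vertices comes from the finitely
  many orbits, together with the fact that percolation from one vertex forces percolation from every
  other one (\<open>tight_connected\<close>, \<open>uniform_tail\<close>).

  The factor \<open>1 / c\<close> is absorbed into the rate (\<open>uniform_rate\<close>) once the probabilities for
  the smallest admissible \<open>n\<close> are bounded away from 1. For sites that probability is at most \<open>p\<close>.
  For bonds it is the probability of having an open incident edge, so a degree bound is needed. This
  bound is automatic: a vertex of large degree has a large cluster, which would contradict the lower
  bound \<open>c\<close> on its expected weight (\<open>bond_degree_bound\<close>).

  All comparisons are made for finite sets of edges or vertices, where expectations are finite sums;
  continuity of measure transfers the bounds to the infinite graph. Bond and site percolation are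
  both instances of the locale \<open>spread\<close>.
\<close>

section \<open>Expectations over finitely many independent items\<close>

text \<open>The set of open items is random here, with Bernoulli weights. An explicit sum makes it
  possible to condition on the state of one item by pure algebra.\<close>
definition bern_expect :: "real \<Rightarrow> 'i set \<Rightarrow> ('i set \<Rightarrow> real) \<Rightarrow> real" where
  "bern_expect p F g = (\<Sum>A\<in>Pow F. p ^ card A * (1 - p) ^ card (F - A) * g A)"

lemma bern_expect_empty [simp]: "bern_expect p {} g = g {}"
  by (simp add: bern_expect_def)

lemma bern_expect_insert:
  assumes "finite F" "i \<notin> F"
  shows "bern_expect p (insert i F) g
    = p * bern_expect p F (\<lambda>A. g (insert i A)) + (1 - p) * bern_expect p F g"
proof -
  let ?w = "\<lambda>A. p ^ card A * (1 - p) ^ card (insert i F - A) * g A"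
  have disj: "Pow F \<inter> insert i ` Pow F = {}"
    using assms by auto
  have inj: "inj_on (insert i) (Pow F)"
    using assms by (auto simp: inj_on_def)
  have open_part: "?w (insert i A) = p * (p ^ card A * (1 - p) ^ card (F - A) * g (insert i A))"
    if "A \<in> Pow F" for A
  proof -
    have "insert i F - insert i A = F - A" "card (insert i A) = Suc (card A)"
      using that assms by (auto simp: finite_subset intro!: card_insert_disjoint)
    then show ?thesis by simp
  qed
  have closed_part: "?w A = (1 - p) * (p ^ card A * (1 - p) ^ card (F - A) * g A)"
    if "A \<in> Pow F" for A
  proof -
    have "insert i F - A = insert i (F - A)" using that assms by auto
    then have "card (insert i F - A) = Suc (card (F - A))"
      using assms by simp
    then show ?thesis by simp
  qed
  have "bern_expect p (insert i F) g = sum ?w (Pow F) + sum ?w (insert i ` Pow F)"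
    using assms disj by (simp add: bern_expect_def Pow_insert sum.union_disjoint)
  also have "sum ?w (insert i ` Pow F) = (\<Sum>A\<in>Pow F. ?w (insert i A))"
    by (simp add: sum.reindex[OF inj])
  finally show ?thesis
    by (simp only: bern_expect_def sum_distrib_left open_part closed_part sum.cong[OF refl open_part]
        sum.cong[OF refl closed_part] add.commute)
qed

lemma bern_expect_mono:
  assumes "0 \<le> p" "p \<le> 1" "\<And>A. A \<subseteq> F \<Longrightarrow> f A \<le> g A"
  shows "bern_expect p F f \<le> bern_expect p F g"
  unfolding bern_expect_def using assms by (intro sum_mono mult_left_mono) auto

lemma bern_expect_scale: "bern_expect p F (\<lambda>A. k * g A) = k * bern_expect p F g"
  unfolding bern_expect_def sum_distrib_left by (intro sum.cong) auto

lemma bern_expect_diff: "bern_expect p F (\<lambda>A. f A - g A) = bern_expect p F f - bern_expect p F g"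
  unfolding bern_expect_def by (simp add: algebra_simps sum_subtractf)

text \<open>The generating function of a binomial variable; \<open>t = 0\<close> gives the probability that
  all items of \<open>S\<close> are closed.\<close>
lemma bern_expect_power_card:
  assumes "finite F" "S \<subseteq> F"
  shows "bern_expect p F (\<lambda>A. t ^ card (A \<inter> S)) = (1 - p + p * t) ^ card S"
  using assms
proof (induction F arbitrary: S rule: finite_induct)
  case (insert i F)
  show ?case
  proof (cases "i \<in> S")
    case True
    define T where "T = S - {i}"
    have T: "T \<subseteq> F" "S = insert i T" "i \<notin> T" "finite T"
      using True insert finite_subset[of T F] by (auto simp: T_def)
    have "bern_expect p F (\<lambda>A. t ^ card (insert i A \<inter> S)) = bern_expect p F (\<lambda>A. t * t ^ card (A \<inter> T))"
      unfolding bern_expect_def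
    proof (intro sum.cong refl)
      fix A assume A: "A \<in> Pow F"
      have "insert i A \<inter> S = insert i (A \<inter> T)" "i \<notin> A \<inter> T" "finite (A \<inter> T)" using T A insert by auto
      then show "p ^ card A * (1 - p) ^ card (F - A) * t ^ card (insert i A \<inter> S)
        = p ^ card A * (1 - p) ^ card (F - A) * (t * t ^ card (A \<inter> T))" by simp
    qed
    moreover have "bern_expect p F (\<lambda>A. t ^ card (A \<inter> S)) = bern_expect p F (\<lambda>A. t ^ card (A \<inter> T))"
      unfolding bern_expect_def
    proof (intro sum.cong refl)
      fix A assume A: "A \<in> Pow F"
      have "A \<inter> S = A \<inter> T" using T A insert by auto
      then show "p ^ card A * (1 - p) ^ card (F - A) * t ^ card (A \<inter> S)
        = p ^ card A * (1 - p) ^ card (F - A) * (t ^ card (A \<inter> T))" by simp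
    qed
    ultimately show ?thesis
      using insert T by (simp add: bern_expect_insert bern_expect_scale algebra_simps)
  next
    case False
    then have "S \<subseteq> F" "\<And>A. insert i A \<inter> S = A \<inter> S" using insert by auto
    then show ?thesis using insert by (simp add: bern_expect_insert algebra_simps)
  qed
qed simp

lemma bern_expect_const: "finite F \<Longrightarrow> bern_expect p F (\<lambda>_. k) = k"
  using bern_expect_power_card[of F "{}" p 1] bern_expect_scale[of p F k "\<lambda>_. 1"] by simp

lemma bern_expect_0: "finite F \<Longrightarrow> bern_expect 0 F g = g {}"
  by (induction F rule: finite_induct) (auto simp: bern_expect_insert)

lemma bern_expect_mono_family:
  assumes "0 \<le> p" "p \<le> 1" "finite G" "F \<subseteq> G"
    and "\<And>A B. A \<subseteq> B \<Longrightarrow> B \<subseteq> G \<Longrightarrow> g A \<le> g B"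
  shows "bern_expect p F g \<le> bern_expect p G g"
proof -
  have "finite (G - F)" "(G - F) \<inter> F = {}" "finite F" using assms finite_subset by auto
  moreover have "bern_expect p F g \<le> bern_expect p (D \<union> F) g" if "finite D" "D \<inter> F = {}" "D \<subseteq> G" for D
    using that
  proof (induction D rule: finite_induct)
    case (insert i D)
    have fin: "finite (D \<union> F)" using insert \<open>finite F\<close> by auto
    have "bern_expect p (D \<union> F) g \<le> bern_expect p (D \<union> F) (\<lambda>A. g (insert i A))"
      using insert assms by (intro bern_expect_mono assms) auto
    then have "p * bern_expect p (D \<union> F) g \<le> p * bern_expect p (D \<union> F) (\<lambda>A. g (insert i A))"
      using assms by (intro mult_left_mono) auto
    then have "bern_expect p (D \<union> F) g \<le> bern_expect p (insert i (D \<union> F)) g"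
      using bern_expect_insert[of "D \<union> F" i p g] insert fin by (simp add: algebra_simps)
    then show ?case using insert by auto
  qed simp
  moreover have "(G - F) \<union> F = G" using assms by auto
  ultimately show ?thesis by (metis Diff_subset)
qed

text \<open>Insertion tolerance: requiring \<open>i\<close> to be open costs a factor \<open>p\<close> and can only
  help an increasing \<open>g\<close>.\<close>
lemma bern_expect_forced_open:
  assumes "0 \<le> p" "p \<le> 1" "finite F"
    and mono: "\<And>A B. A \<subseteq> B \<Longrightarrow> B \<subseteq> insert i F \<Longrightarrow> g A \<le> g B"
  shows "p * bern_expect p F g \<le> bern_expect p (insert i F) (\<lambda>A. of_bool (i \<in> A) * g A)"
proof -
  define G where "G = F - {i}"
  have G: "finite G" "i \<notin> G" "insert i F = insert i G" "F \<subseteq> insert i G" using assms by (auto simp: G_def)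
  have "bern_expect p G g \<le> bern_expect p G (\<lambda>A. g (insert i A))"
    by (intro bern_expect_mono mono assms(1,2)) (use G in auto)
  then have le: "(1 - p) * bern_expect p G g \<le> (1 - p) * bern_expect p G (\<lambda>A. g (insert i A))"
    using assms by (intro mult_left_mono) auto
  have "bern_expect p F g \<le> bern_expect p (insert i G) g"
    using assms G by (intro bern_expect_mono_family) auto
  also have "\<dots> \<le> bern_expect p G (\<lambda>A. g (insert i A))"
    using le bern_expect_insert[OF G(1,2), of p g] by (simp add: algebra_simps)
  finally have "p * bern_expect p F g \<le> p * bern_expect p G (\<lambda>A. g (insert i A))"
    using assms by (intro mult_left_mono) auto
  also have "bern_expect p G (\<lambda>A. of_bool (i \<in> A) * g A) = 0"
    unfolding bern_expect_def using G by (intro sum.neutral) auto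
  then have "p * bern_expect p G (\<lambda>A. g (insert i A))
    = bern_expect p (insert i G) (\<lambda>A. of_bool (i \<in> A) * g A)"
    using bern_expect_insert[OF G(1,2), of p "\<lambda>A. of_bool (i \<in> A) * g A"] by simp
  finally show ?thesis using G by simp
qed

text \<open>The Harris inequality, by conditioning on one item at a time: the difference of the two
  sides is then the product of two increments of equal sign.\<close>
lemma bern_expect_harris:
  assumes "0 \<le> p" "p \<le> 1" "finite F"
    and "\<And>A B. A \<subseteq> B \<Longrightarrow> B \<subseteq> F \<Longrightarrow> f B \<le> f A"
    and "\<And>A B. A \<subseteq> B \<Longrightarrow> B \<subseteq> F \<Longrightarrow> g B \<le> g A"
  shows "bern_expect p F f * bern_expect p F g \<le> bern_expect p F (\<lambda>A. f A * g A)"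
  using assms(3-5)
proof (induction F arbitrary: f g rule: finite_induct)
  case (insert i F)
  let ?f1 = "\<lambda>A. f (insert i A)" and ?g1 = "\<lambda>A. g (insert i A)"
  define f0 f1 g0 g1 where "f0 = bern_expect p F f" and "f1 = bern_expect p F ?f1"
    and "g0 = bern_expect p F g" and "g1 = bern_expect p F ?g1"
  have "f1 \<le> f0" "g1 \<le> g0" unfolding f0_def f1_def g0_def g1_def
    by (intro bern_expect_mono insert.prems assms(1,2); auto)+
  then have "0 \<le> p * (1 - p) * ((f0 - f1) * (g0 - g1))"
    using assms by (intro mult_nonneg_nonneg) auto
  then have "(p * f1 + (1 - p) * f0) * (p * g1 + (1 - p) * g0) \<le> p * (f1 * g1) + (1 - p) * (f0 * g0)"
    by (simp add: algebra_simps)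
  also have "f1 * g1 \<le> bern_expect p F (\<lambda>A. ?f1 A * ?g1 A)"
    unfolding f1_def g1_def by (rule insert.IH) (use insert.prems in \<open>auto intro!: insert.prems insert_mono\<close>)
  then have "p * (f1 * g1) \<le> p * bern_expect p F (\<lambda>A. ?f1 A * ?g1 A)"
    using assms by (intro mult_left_mono) auto
  also have "f0 * g0 \<le> bern_expect p F (\<lambda>A. f A * g A)"
    unfolding f0_def g0_def by (rule insert.IH; meson insert.prems subset_insertI2)
  then have "(1 - p) * (f0 * g0) \<le> (1 - p) * bern_expect p F (\<lambda>A. f A * g A)"
    using assms by (intro mult_left_mono) auto
  finally show ?case
    using insert unfolding f0_def f1_def g0_def g1_def by (simp add: bern_expect_insert)
qed simp

lemma bern_expect_reindex:
  assumes "inj_on \<sigma> F"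
  shows "bern_expect p (\<sigma> ` F) g = bern_expect p F (\<lambda>A. g (\<sigma> ` A))"
proof -
  have Pow: "Pow (\<sigma> ` F) = (`) \<sigma> ` Pow F" by (simp add: image_Pow_surj)
  have inj: "inj_on ((`) \<sigma>) (Pow F)" using assms by (simp add: inj_on_image_Pow)
  have "card (\<sigma> ` A) = card A" "card (\<sigma> ` F - \<sigma> ` A) = card (F - A)" if "A \<in> Pow F" for A
  proof -
    show "card (\<sigma> ` A) = card A" using that assms by (meson PowD card_image inj_on_subset)
    have "\<sigma> ` F - \<sigma> ` A = \<sigma> ` (F - A)" using that assms by (simp add: inj_on_image_set_diff[of \<sigma> F])
    then show "card (\<sigma> ` F - \<sigma> ` A) = card (F - A)"
      using that assms by (metis Diff_subset card_image inj_on_subset)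
  qed
  then show ?thesis
    unfolding bern_expect_def Pow by (simp add: sum.reindex[OF inj])
qed

text \<open>The bridge to the product measure: an event that depends on finitely many items is a
  finite disjoint union of cylinders.\<close>
lemma prob_percolation_finite:
  assumes p: "p \<in> {0..1}" and "finite F" "F \<subseteq> I"
  shows "\<P>(\<omega> in percolation_measure I p. Q {i \<in> F. \<omega> i}) = bern_expect p F (\<lambda>A. of_bool (Q A))"
    and "{\<omega> \<in> space (percolation_measure I p). Q {i \<in> F. \<omega> i}} \<in> sets (percolation_measure I p)"
proof -
  let ?M = "percolation_measure I p"
  interpret product_prob_space "\<lambda>_. measure_pmf (bernoulli_pmf p)" I
    by standard
  define X where "X A = prod_emb I (\<lambda>_. measure_pmf (bernoulli_pmf p)) F (\<Pi>\<^sub>E i\<in>F. {i \<in> A})" for A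
  have X: "X A = {\<omega> \<in> space ?M. {i \<in> F. \<omega> i} = A}" if "A \<subseteq> F" for A
    using that assms(3) unfolding X_def percolation_measure_def prod_emb_def space_PiM
    by (auto simp: PiE_iff restrict_def extensional_def)
  have meas: "X A \<in> sets ?M" for A
    unfolding X_def percolation_measure_def using assms by (intro sets_PiM_I) auto
  have prob: "measure ?M (X A) = p ^ card A * (1 - p) ^ card (F - A)" if "A \<subseteq> F" for A
  proof -
    have "measure ?M (X A) = (\<Prod>i\<in>F. measure (measure_pmf (bernoulli_pmf p)) {i \<in> A})"
      unfolding X_def percolation_measure_def using assms by (subst measure_PiM_emb) auto
    also have "\<dots> = (\<Prod>i\<in>F. if i \<in> A then p else 1 - p)"
      using p by (intro prod.cong) (auto simp: measure_pmf_single)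
    also have "\<dots> = (\<Prod>i\<in>A. p) * (\<Prod>i\<in>F - A. 1 - p)"
      using that assms by (subst prod.If_cases) (auto simp: Int_absorb1 Diff_eq)
    finally show ?thesis by simp
  qed
  have eq: "{\<omega> \<in> space ?M. Q {i \<in> F. \<omega> i}} = (\<Union>A\<in>{A\<in>Pow F. Q A}. X A)"
    using X by auto
  show "{\<omega> \<in> space ?M. Q {i \<in> F. \<omega> i}} \<in> sets ?M"
    unfolding eq using meas assms by (intro sets.finite_UN) auto
  have "measure ?M (\<Union>A\<in>{A\<in>Pow F. Q A}. X A) = (\<Sum>A\<in>{A\<in>Pow F. Q A}. measure ?M (X A))"
  proof (rule measure_finite_Union)
    show "disjoint_family_on X {A \<in> Pow F. Q A}"
      using X by (auto simp: disjoint_family_on_def)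
    show "emeasure ?M (X A) \<noteq> \<infinity>" for A
      by (simp add: percolation_measure_def)
  qed (use assms meas in auto)
  also have "\<dots> = bern_expect p F (\<lambda>A. of_bool (Q A))"
    unfolding bern_expect_def using assms
    by (intro sum.mono_neutral_cong_left) (auto simp: prob)
  finally show "\<P>(\<omega> in ?M. Q {i \<in> F. \<omega> i}) = bern_expect p F (\<lambda>A. of_bool (Q A))"
    unfolding eq .
qed

section \<open>Reachability through open items\<close>

text \<open>Each item \<open>i\<close> carries a set \<open>R i\<close> of directed steps which it allows when it
  is open.\<close>
definition reach :: "('i \<Rightarrow> 'a rel) \<Rightarrow> 'i set \<Rightarrow> 'a set \<Rightarrow> 'a set" where
  "reach R A W = (\<Union>i\<in>A. R i)\<^sup>* `` W"

lemma reach_mono: "A \<subseteq> B \<Longrightarrow> W \<subseteq> W' \<Longrightarrow> reach R A W \<subseteq> reach R B W'"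
  unfolding reach_def by (intro Image_mono rtrancl_mono UN_mono) auto

lemma reach_refl: "W \<subseteq> reach R A W"
  unfolding reach_def by blast

lemma reach_Un: "reach R A (W \<union> W') = reach R A W \<union> reach R A W'"
  unfolding reach_def by blast

lemma reach_empty [simp]: "reach R {} W = W"
  by (auto simp: reach_def)

lemma reach_closed:
  assumes "W \<subseteq> S" "\<And>i x y. i \<in> A \<Longrightarrow> x \<in> S \<Longrightarrow> (x, y) \<in> R i \<Longrightarrow> y \<in> S"
  shows "reach R A W \<subseteq> S"
proof -
  have "v \<in> S" if "(u, v) \<in> (\<Union>i\<in>A. R i)\<^sup>*" "u \<in> S" for u v
    using that by (induction rule: rtrancl_induct) (use assms in auto)
  then show ?thesis using assms(1) unfolding reach_def by blast
qed

lemma reach_step: "y \<in> reach R A W \<Longrightarrow> i \<in> A \<Longrightarrow> (y, z) \<in> R i \<Longrightarrow> z \<in> reach R A W"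
  unfolding reach_def by (blast intro: rtrancl_into_rtrancl)

lemma reach_from_reached: "W' \<subseteq> reach R A W \<Longrightarrow> reach R A W' \<subseteq> reach R A W"
  by (rule reach_closed) (auto intro: reach_step)

text \<open>Paths are finite, so finitely many reached vertices are already reached through finitely
  many items.\<close>
lemma reach_finite_witness:
  assumes "finite B" "B \<subseteq> reach R A {x}"
  obtains F where "finite F" "F \<subseteq> A" "B \<subseteq> reach R F {x}"
proof -
  have single: "\<exists>F. finite F \<and> F \<subseteq> A \<and> y \<in> reach R F {x}" if "y \<in> reach R A {x}" for y
  proof -
    have "(x, y) \<in> (\<Union>i\<in>A. R i)\<^sup>*" using that by (auto simp: reach_def)
    then show ?thesis
    proof (induction rule: rtrancl_induct)
      case base
      show ?case by (rule exI[of _ "{}"]) simp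
    next
      case (step y z)
      then obtain F i where F: "finite F" "F \<subseteq> A" "y \<in> reach R F {x}" "i \<in> A" "(y, z) \<in> R i" by auto
      then have "y \<in> reach R (insert i F) {x}"
        using reach_mono[of F "insert i F" "{x}" "{x}" R] by auto
      then have "z \<in> reach R (insert i F) {x}" using F by (meson reach_step insertI1)
      then show ?case using F by (intro exI[of _ "insert i F"]) auto
    qed
  qed
  then obtain G where G: "\<And>y. y \<in> B \<Longrightarrow> finite (G y) \<and> G y \<subseteq> A \<and> y \<in> reach R (G y) {x}"
    using assms by (metis subsetD)
  have "B \<subseteq> reach R (\<Union>(G ` B)) {x}"
  proof
    fix y assume "y \<in> B"
    then have "G y \<subseteq> \<Union>(G ` B)" by auto
    then show "y \<in> reach R (\<Union>(G ` B)) {x}" using G[OF \<open>y \<in> B\<close>] reach_mono[of _ _ "{x}" "{x}" R] by blast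
  qed
  then show thesis using that[of "\<Union>(G ` B)"] G assms by blast
qed

lemma reach_image:
  assumes "inj_on \<gamma> V" "x \<in> V"
    and "\<And>i. i \<in> A \<Longrightarrow> R i \<subseteq> V \<times> V" "\<And>i. i \<in> A \<Longrightarrow> R (\<sigma> i) \<subseteq> V \<times> V" 
    and "\<gamma> ` V = V"
    and "\<And>i u v. i \<in> A \<Longrightarrow> u \<in> V \<Longrightarrow> v \<in> V \<Longrightarrow> (\<gamma> u, \<gamma> v) \<in> R (\<sigma> i) \<longleftrightarrow> (u, v) \<in> R i"
  shows "reach R (\<sigma> ` A) {\<gamma> x} = \<gamma> ` reach R A {x}"
proof
  have sub: "reach R A {x} \<subseteq> V" using assms by (intro reach_closed) auto
  show "reach R (\<sigma> ` A) {\<gamma> x} \<subseteq> \<gamma> ` reach R A {x}"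
  proof (rule reach_closed)
    fix j y z assume j: "j \<in> \<sigma> ` A" "y \<in> \<gamma> ` reach R A {x}" "(y, z) \<in> R j"
    then obtain i u where i: "i \<in> A" "j = \<sigma> i" "u \<in> reach R A {x}" "y = \<gamma> u" by blast
    have "z \<in> V" using i j assms(4) by blast
    then obtain v where v: "v \<in> V" "z = \<gamma> v" using assms(5) by blast
    then have "(u, v) \<in> R i" using i j sub assms(6)[of i u v] by blast
    then show "z \<in> \<gamma> ` reach R A {x}" using i v reach_step[of u R A "{x}" i v] by blast
  qed (use reach_refl[of "{x}"] in blast)
  have "reach R A {x} \<subseteq> {v \<in> V. \<gamma> v \<in> reach R (\<sigma> ` A) {\<gamma> x}}"
  proof (rule reach_closed)
    show "{x} \<subseteq> {v \<in> V. \<gamma> v \<in> reach R (\<sigma> ` A) {\<gamma> x}}"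
      using assms(2) reach_refl[of "{\<gamma> x}"] by blast
    fix i u v assume i: "i \<in> A" "u \<in> {v \<in> V. \<gamma> v \<in> reach R (\<sigma> ` A) {\<gamma> x}}" "(u, v) \<in> R i"
    then have "v \<in> V" using assms(3) by blast
    moreover have "(\<gamma> u, \<gamma> v) \<in> R (\<sigma> i)" using assms(6)[of i u v] i \<open>v \<in> V\<close> by blast
    ultimately show "v \<in> {v \<in> V. \<gamma> v \<in> reach R (\<sigma> ` A) {\<gamma> x}}"
      using i reach_step[of "\<gamma> u" R "\<sigma> ` A" "{\<gamma> x}" "\<sigma> i" "\<gamma> v"] by blast
  qed
  then show "\<gamma> ` reach R A {x} \<subseteq> reach R (\<sigma> ` A) {\<gamma> x}" by blast
qed

text \<open>The two-point comparison behind \<open>tilted_domination\<close>. Here \<open>g1\<close> and \<open>g0\<close> are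
  expectations under \<open>q\<close>, and \<open>a1\<close> and \<open>a0\<close> are expected weights under \<open>p\<close>,
  given that the next item is open or closed. The tilted probability of an open item is
  \<open>p * a1 / (p * a1 + (1 - p) * a0)\<close>; it is at least \<open>p * c\<close>, hence at least \<open>q\<close>.\<close>
lemma tilt_step:
  fixes p q c a0 a1 g0 g1 :: real
  assumes "0 \<le> q" "q \<le> p * c" "0 \<le> p" "p \<le> 1" "0 \<le> a0" "c * a0 \<le> a1" "a1 \<le> a0" "g0 \<le> g1"
  shows "(q * g1 + (1 - q) * g0) * (p * a1 + (1 - p) * a0) \<le> p * (g1 * a1) + (1 - p) * (g0 * a0)"
proof -
  have "p * a1 + (1 - p) * a0 \<le> a0"
    using mult_left_mono[OF assms(7) assms(3)] by (simp add: algebra_simps)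
  then have "q * (p * a1 + (1 - p) * a0) \<le> q * a0"
    using assms by (intro mult_left_mono) auto
  also have "\<dots> \<le> p * c * a0" using assms by (intro mult_right_mono) auto
  also have "\<dots> \<le> p * a1" using mult_left_mono[OF assms(6) assms(3)] by (simp add: mult.assoc)
  finally have "0 \<le> (g1 - g0) * (p * a1 - q * (p * a1 + (1 - p) * a0))"
    using assms by (intro mult_nonneg_nonneg) auto
  then show ?thesis by (simp add: algebra_simps)
qed

section \<open>Exploring a cluster item by item\<close>

text \<open>The common abstraction of bond and site percolation. For bonds the items are the edges, and
  an edge allows both directions. For sites the items are the vertices, and a vertex \<open>v\<close> allows
  all steps into \<open>v\<close> from its neighbours. The condition on \<open>Range\<close> says that after an open item
  has been used for a step from \<open>x\<close> to \<open>y\<close>, its other steps lead only to \<open>x\<close> or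
  \<open>y\<close>. A cluster exploration can therefore discard each item once it is revealed.\<close>
locale spread =
  fixes I :: "'i set" and R :: "'i \<Rightarrow> 'a rel" and V :: "'a set"
  assumes countable_items: "countable I"
    and R_sub: "i \<in> I \<Longrightarrow> R i \<subseteq> V \<times> V"
    and R_range: "i \<in> I \<Longrightarrow> (x, y) \<in> R i \<Longrightarrow> Range (R i) \<subseteq> {x, y}"
begin

lemma finite_Range: "i \<in> I \<Longrightarrow> finite (Range (R i))"
proof (cases "R i = {}")
  case False
  assume "i \<in> I"
  moreover obtain x y where "(x, y) \<in> R i" using False by auto
  ultimately show ?thesis by (metis R_range finite.simps finite_subset)
qed simp

lemma finite_reach:
  assumes "finite A" "A \<subseteq> I" "finite W"
  shows "finite (reach R A W)"
proof (rule finite_subset)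
  show "reach R A W \<subseteq> W \<union> (\<Union>i\<in>A. Range (R i))" by (rule reach_closed) auto
  show "finite (W \<union> (\<Union>i\<in>A. Range (R i)))" using assms finite_Range by auto
qed

lemma card_reach_mono:
  assumes "A \<subseteq> B" "B \<subseteq> F" "finite F" "F \<subseteq> I" "W \<subseteq> W'" "finite W'"
  shows "card (reach R A W) \<le> card (reach R B W')"
  using assms by (intro card_mono finite_reach reach_mono) (auto intro: finite_subset)

text \<open>The exploration step: when \<open>i\<close> turns out to be open, \<open>y\<close> joins the explored set
  and \<open>i\<close> has nothing further to contribute.\<close>
lemma reach_open_item:
  assumes "i \<in> I" "x \<in> W" "(x, y) \<in> R i"
  shows "reach R (insert i A) W = reach R A (insert y W)"
proof
  show "reach R (insert i A) W \<subseteq> reach R A (insert y W)"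
  proof (rule reach_closed)
    show "W \<subseteq> reach R A (insert y W)" using reach_refl[of "insert y W"] by blast
    fix j u v assume j: "j \<in> insert i A" "u \<in> reach R A (insert y W)" "(u, v) \<in> R j"
    show "v \<in> reach R A (insert y W)"
    proof (cases "j \<in> A")
      case True
      then show ?thesis using j reach_step by metis
    next
      case False
      then have "v \<in> {x, y}" using j R_range[OF assms(1,3)] by auto
      then show ?thesis using assms(2) reach_refl[of "insert y W" R A] by blast
    qed
  qed
  show "reach R A (insert y W) \<subseteq> reach R (insert i A) W"
  proof (rule reach_closed)
    have "W \<subseteq> reach R (insert i A) W" by (rule reach_refl)
    then show "insert y W \<subseteq> reach R (insert i A) W"
      using assms reach_step[of x R "insert i A" W i y] by blast
  qed (auto intro: reach_step)
qed

section \<open>Comparison with the tilted law\<close>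

text \<open>Adding a starting point \<open>y\<close> costs at most the weight of the cluster of \<open>y\<close>: cluster
  sizes are subadditive, and the two weights are decreasing, hence positively correlated.\<close>
lemma expect_weight_insert:
  assumes p: "0 \<le> p" "p \<le> 1" and w: "0 \<le> w" "w \<le> 1" and F: "finite F" "F \<subseteq> I" and W: "finite W"
    and c: "c \<le> bern_expect p F (\<lambda>A. w ^ card (reach R A {y}))"
  shows "c * bern_expect p F (\<lambda>A. w ^ card (reach R A W))
    \<le> bern_expect p F (\<lambda>A. w ^ card (reach R A (insert y W)))"
proof -
  have dec: "w ^ card (reach R B U) \<le> w ^ card (reach R A U)" if "A \<subseteq> B" "B \<subseteq> F" "finite U" for A B U
    using that F w by (intro power_decreasing card_reach_mono[of A B F]) auto
  have "0 \<le> bern_expect p F (\<lambda>A. w ^ card (reach R A W))"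
    using w p bern_expect_mono[of p F "\<lambda>_. 0"] bern_expect_const[of F p 0] F by simp
  then have "c * bern_expect p F (\<lambda>A. w ^ card (reach R A W))
    \<le> bern_expect p F (\<lambda>A. w ^ card (reach R A {y})) * bern_expect p F (\<lambda>A. w ^ card (reach R A W))"
    using c by (intro mult_right_mono)
  also have "\<dots> \<le> bern_expect p F (\<lambda>A. w ^ card (reach R A {y}) * w ^ card (reach R A W))"
    by (intro bern_expect_harris p F(1)) (auto intro!: dec W)
  also have "\<dots> \<le> bern_expect p F (\<lambda>A. w ^ card (reach R A (insert y W)))"
  proof (intro bern_expect_mono p)
    fix A assume "A \<subseteq> F"
    have "reach R A (insert y W) = reach R A {y} \<union> reach R A W"
      using reach_Un[of R A "{y}" W] by simp
    then have "card (reach R A (insert y W)) \<le> card (reach R A {y}) + card (reach R A W)"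
      by (metis card_Un_le)
    then show "w ^ card (reach R A {y}) * w ^ card (reach R A W) \<le> w ^ card (reach R A (insert y W))"
      using w by (simp add: power_add[symmetric] power_decreasing)
  qed
  finally show ?thesis .
qed

text \<open>The heart of the proof. It says that the cluster under parameter \<open>p\<close>, tilted by
  \<open>w\<close> to the power of its size, stochastically dominates the cluster under parameter \<open>q\<close>.
  The statement is multiplied out, and formulated for an arbitrary explored set \<open>W\<close>, so that
  induction over the unrevealed items applies.\<close>
lemma tilted_domination:
  fixes f :: "'a set \<Rightarrow> real"
  assumes p: "0 \<le> p" "p \<le> 1" and q: "0 \<le> q" "q \<le> 1" "q \<le> p * c" and w: "0 \<le> w" "w \<le> 1"
    and F: "finite F" "F \<subseteq> I" and W: "finite W"
    and c: "\<And>G y. G \<subseteq> F \<Longrightarrow> y \<in> V \<Longrightarrow> c \<le> bern_expect p G (\<lambda>A. w ^ card (reach R A {y}))"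
    and f: "\<And>C D. C \<subseteq> D \<Longrightarrow> finite D \<Longrightarrow> f C \<le> f D"
  shows "bern_expect q F (\<lambda>A. f (reach R A W)) * bern_expect p F (\<lambda>A. w ^ card (reach R A W))
    \<le> bern_expect p F (\<lambda>A. f (reach R A W) * w ^ card (reach R A W))"
  using F W c
proof (induction "card F" arbitrary: F W)
  case 0
  then show ?case by simp
next
  case (Suc n)
  show ?case
  proof (cases "\<exists>i\<in>F. \<exists>x\<in>W. \<exists>y. (x, y) \<in> R i")
    \<comment> \<open>No unrevealed item leaves \<open>W\<close>: the cluster is deterministic.\<close>
    case False
    have "reach R A W = W" if "A \<subseteq> F" for A
      using False that by (intro antisym reach_closed reach_refl) auto
    then have "bern_expect r F (\<lambda>A. h (reach R A W)) = bern_expect r F (\<lambda>_. h W)" for r and h :: "_ \<Rightarrow> real"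
      unfolding bern_expect_def by (intro sum.cong) auto
    from this[of q f] this[of p "\<lambda>C. w ^ card C"] this[of p "\<lambda>C. f C * w ^ card C"]
    show ?thesis using Suc.prems by (simp add: bern_expect_const)
  next
    case True
    then obtain i x y where i: "i \<in> F" "x \<in> W" "(x, y) \<in> R i" by auto
    define G where "G = F - {i}"
    have G: "finite G" "i \<notin> G" "F = insert i G" "G \<subseteq> F" "G \<subseteq> I" "n = card G"
      using i Suc.prems Suc.hyps(2) by (auto simp: G_def)
    have "i \<in> I" "y \<in> V" using i Suc.prems R_sub by blast+
    define E where "E r h U = bern_expect r G (\<lambda>A. h (reach R A U))" for r and h :: "'a set \<Rightarrow> real" and U
    let ?W' = "insert y W" and ?w = "\<lambda>C. w ^ card C" and ?fw = "\<lambda>C. f C * w ^ card C"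
    have expand: "bern_expect r F (\<lambda>A. h (reach R A W)) = r * E r h ?W' + (1 - r) * E r h W" for r h
      using bern_expect_insert[OF G(1,2), of r "\<lambda>A. h (reach R A W)"] G(3)
        reach_open_item[OF \<open>i \<in> I\<close> i(2,3)] by (simp add: E_def)
    have IH: "E q f U * E p ?w U \<le> E p ?fw U" if "finite U" for U
      unfolding E_def using that G Suc.prems(4) by (intro Suc.hyps(1)) auto
    have fin: "finite (reach R A U)" if "A \<subseteq> G" "finite U" for A U
      using that G by (intro finite_reach) (auto intro: finite_subset)
    have "E q f W \<le> E q f ?W'"
      unfolding E_def using Suc.prems fin by (intro bern_expect_mono q f reach_mono) auto
    moreover have "E p ?w ?W' \<le> E p ?w W"
      unfolding E_def using Suc.prems G w
      by (intro bern_expect_mono p power_decreasing card_reach_mono[of _ _ G]) auto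
    moreover have "c * E p ?w W \<le> E p ?w ?W'"
      unfolding E_def using Suc.prems G \<open>y \<in> V\<close>
      by (intro expect_weight_insert p w) auto
    moreover have "0 \<le> E p ?w W"
      unfolding E_def
      using w p bern_expect_mono[of p G "\<lambda>_. 0"] bern_expect_const[of G p 0] G by simp
    ultimately have "(q * E q f ?W' + (1 - q) * E q f W) * (p * E p ?w ?W' + (1 - p) * E p ?w W)
      \<le> p * (E q f ?W' * E p ?w ?W') + (1 - p) * (E q f W * E p ?w W)"
      by (intro tilt_step[where c = c] p q) auto
    also have "\<dots> \<le> p * E p ?fw ?W' + (1 - p) * E p ?fw W"
      using IH[of ?W'] IH[of W] Suc.prems p by (intro add_mono mult_left_mono) auto
    finally show ?thesis using expand[of q f] expand[of p ?w] expand[of p ?fw] by simp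
  qed
qed

text \<open>Domination applied to the event of a cluster of size at least \<open>n\<close>, on which the weight
  is at most \<open>w ^ n\<close>.\<close>
lemma finite_tail_bound:
  assumes p: "0 \<le> p" "p \<le> 1" and q: "0 \<le> q" "q \<le> 1" "q \<le> p * c" and w: "0 \<le> w" "w \<le> 1"
    and F: "finite F" "F \<subseteq> I" and c0: "0 < c" and x: "x \<in> V"
    and c: "\<And>G y. finite G \<Longrightarrow> G \<subseteq> I \<Longrightarrow> y \<in> V \<Longrightarrow> c \<le> bern_expect p G (\<lambda>A. w ^ card (reach R A {y}))"
  shows "bern_expect q F (\<lambda>A. of_bool (n \<le> card (reach R A {x}))) \<le> w ^ n / c"
proof -
  let ?f = "\<lambda>C. of_bool (n \<le> card C) :: real"
  have "bern_expect q F (\<lambda>A. ?f (reach R A {x})) * c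
    \<le> bern_expect q F (\<lambda>A. ?f (reach R A {x})) * bern_expect p F (\<lambda>A. w ^ card (reach R A {x}))"
    using c[OF F x] q bern_expect_mono[of q F "\<lambda>_. 0"] bern_expect_const[of F q 0] F
    by (intro mult_left_mono) auto
  also have "\<dots> \<le> bern_expect p F (\<lambda>A. ?f (reach R A {x}) * w ^ card (reach R A {x}))"
  proof (rule tilted_domination[OF p q w F])
    show "?f C \<le> ?f D" if "C \<subseteq> D" "finite D" for C D
      using card_mono[OF that(2,1)] by auto
  next
    show "c \<le> bern_expect p G (\<lambda>A. w ^ card (reach R A {y}))" if "G \<subseteq> F" "y \<in> V" for G y
      using that F by (intro c) (auto intro: finite_subset)
  qed simp
  also have "\<dots> \<le> bern_expect p F (\<lambda>_. w ^ n)"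
    using w by (intro bern_expect_mono p) (auto intro: power_decreasing)
  finally show ?thesis using c0 F by (simp add: bern_expect_const field_simps)
qed

section \<open>Uniform control of the cluster sizes\<close>

text \<open>Absence of percolation from \<open>x\<close>, expressed through finite subfamilies of items.\<close>
definition tight :: "real \<Rightarrow> 'a \<Rightarrow> bool" where
  "tight p x \<longleftrightarrow> (\<forall>\<epsilon>>0. \<exists>N. \<forall>F. finite F \<longrightarrow> F \<subseteq> I \<longrightarrow>
     bern_expect p F (\<lambda>A. of_bool (N \<le> card (reach R A {x}))) \<le> \<epsilon>)"

lemma tail_mono_in_items:
  assumes "A \<subseteq> B" "B \<subseteq> F" "finite F" "F \<subseteq> I"
  shows "(of_bool (n \<le> card (reach R A {x})) :: real) \<le> of_bool (n \<le> card (reach R B {x}))"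
  using card_reach_mono[OF assms, of "{x}" "{x}"] by auto

text \<open>Forcing the item \<open>i\<close> open makes the cluster of \<open>x\<close> contain that of \<open>y\<close>, at the
  price of a factor \<open>p\<close>.\<close>
lemma tight_neighbour:
  assumes p: "0 < p" "p \<le> 1" and i: "i \<in> I" "(x, y) \<in> R i" and t: "tight p x"
  shows "tight p y"
  unfolding tight_def
proof (intro allI impI)
  fix \<epsilon> :: real assume "0 < \<epsilon>"
  then have "0 < p * \<epsilon>" using p by simp
  then obtain N where N: "\<And>F. finite F \<Longrightarrow> F \<subseteq> I \<Longrightarrow>
     bern_expect p F (\<lambda>A. of_bool (N \<le> card (reach R A {x}))) \<le> p * \<epsilon>"
    using t unfolding tight_def by blast
  have "bern_expect p F (\<lambda>A. of_bool (N \<le> card (reach R A {y}))) \<le> \<epsilon>" if F: "finite F" "F \<subseteq> I" for F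
  proof -
    have F': "finite (insert i F)" "insert i F \<subseteq> I" using F i by auto
    have "p * bern_expect p F (\<lambda>A. of_bool (N \<le> card (reach R A {y})))
      \<le> bern_expect p (insert i F) (\<lambda>A. of_bool (i \<in> A) * of_bool (N \<le> card (reach R A {y})))"
      using p F F' by (intro bern_expect_forced_open tail_mono_in_items[OF _ _ F']) auto
    also have "\<dots> \<le> bern_expect p (insert i F) (\<lambda>A. of_bool (N \<le> card (reach R A {x})))"
    proof (intro bern_expect_mono)
      fix A assume A: "A \<subseteq> insert i F"
      have "card (reach R A {y}) \<le> card (reach R A {x})" if "i \<in> A"
      proof (rule card_mono)
        show "finite (reach R A {x})" using A F' by (intro finite_reach) (auto intro: finite_subset)
        show "reach R A {y} \<subseteq> reach R A {x}"
          using reach_step[of x R A "{x}" i y] that i reach_refl[of "{x}" R A] by (intro reach_from_reached) blast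
      qed
      then show "of_bool (i \<in> A) * of_bool (N \<le> card (reach R A {y}))
        \<le> (of_bool (N \<le> card (reach R A {x})) :: real)" by auto
    qed (use p in auto)
    also have "\<dots> \<le> p * \<epsilon>" using N[OF F'] .
    finally show ?thesis using p by simp
  qed
  then show "\<exists>N. \<forall>F. finite F \<longrightarrow> F \<subseteq> I \<longrightarrow>
     bern_expect p F (\<lambda>A. of_bool (N \<le> card (reach R A {y}))) \<le> \<epsilon>" by blast
qed

lemma tight_connected:
  assumes "0 < p" "p \<le> 1" "(x, y) \<in> (\<Union>i\<in>I. R i)\<^sup>*" "tight p x"
  shows "tight p y"
  using assms(3,4) by (induction rule: rtrancl_induct) (auto intro: tight_neighbour assms(1,2))

text \<open>A graph automorphism \<open>\<gamma>\<close> together with a compatible permutation \<open>\<sigma>\<close> of the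
  items.\<close>
definition symmetry :: "('a \<Rightarrow> 'a) \<Rightarrow> ('i \<Rightarrow> 'i) \<Rightarrow> bool" where
  "symmetry \<gamma> \<sigma> \<longleftrightarrow> bij_betw \<gamma> V V \<and> bij_betw \<sigma> I I \<and>
     (\<forall>i\<in>I. \<forall>u\<in>V. \<forall>v\<in>V. (\<gamma> u, \<gamma> v) \<in> R (\<sigma> i) \<longleftrightarrow> (u, v) \<in> R i)"

lemma tail_symmetry:
  assumes s: "symmetry \<gamma> \<sigma>" and "x \<in> V" "F \<subseteq> I"
  shows "bern_expect p (\<sigma> ` F) (\<lambda>A. of_bool (n \<le> card (reach R A {\<gamma> x})))
    = bern_expect p F (\<lambda>A. of_bool (n \<le> card (reach R A {x})))"
proof -
  have inj: "inj_on \<sigma> F" using s assms(3) by (auto simp: symmetry_def bij_betw_def intro: inj_on_subset)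
  have "card (reach R (\<sigma> ` A) {\<gamma> x}) = card (reach R A {x})" if A: "A \<subseteq> F" for A
  proof -
    have "inj_on \<gamma> V" "\<gamma> ` V = V" using s by (auto simp: symmetry_def bij_betw_def)
    moreover have "R (\<sigma> i) \<subseteq> V \<times> V" if "i \<in> A" for i
      using that A assms(3) s bij_betwE[of \<sigma> I I] by (intro R_sub) (auto simp: symmetry_def)
    ultimately have "reach R (\<sigma> ` A) {\<gamma> x} = \<gamma> ` reach R A {x}"
      using A assms s R_sub by (intro reach_image[where V = V]) (auto simp: symmetry_def subset_iff)
    moreover have "reach R A {x} \<subseteq> V" using A assms R_sub by (intro reach_closed) blast+
    ultimately show ?thesis using \<open>inj_on \<gamma> V\<close> by (metis card_image inj_on_subset)
  qed
  then show ?thesis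
    unfolding bern_expect_reindex[OF inj] unfolding bern_expect_def by (intro sum.cong) auto
qed

text \<open>Tightness holds at each of the finitely many orbit representatives in \<open>T\<close>. A symmetry
  carries the bound to all other vertices, because it permutes the finite families of items.\<close>
lemma uniform_tail:
  assumes p: "0 < p" "p \<le> 1" and \<epsilon>: "0 < \<epsilon>" and T: "finite T" "T \<subseteq> V"
    and orbits: "\<And>x. x \<in> V \<Longrightarrow> \<exists>y\<in>T. \<exists>\<gamma> \<sigma>. symmetry \<gamma> \<sigma> \<and> x = \<gamma> y"
    and conn: "\<And>y. y \<in> V \<Longrightarrow> (x0, y) \<in> (\<Union>i\<in>I. R i)\<^sup>*" and t: "tight p x0"
  obtains N where "\<And>x F. x \<in> V \<Longrightarrow> finite F \<Longrightarrow> F \<subseteq> I \<Longrightarrow>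
     bern_expect p F (\<lambda>A. of_bool (N \<le> card (reach R A {x}))) \<le> \<epsilon>"
proof -
  have "\<exists>N. \<forall>F. finite F \<longrightarrow> F \<subseteq> I \<longrightarrow> 
    bern_expect p F (\<lambda>A. of_bool (N \<le> card (reach R A {y}))) \<le> \<epsilon>" if "y \<in> T" for y
    using tight_connected[OF p conn t] that T \<epsilon> unfolding tight_def by blast
  then obtain N where N: "\<And>y F. y \<in> T \<Longrightarrow> finite F \<Longrightarrow> F \<subseteq> I \<Longrightarrow>
    bern_expect p F (\<lambda>A. of_bool (N y \<le> card (reach R A {y}))) \<le> \<epsilon>"
    by metis
  show thesis
  proof (rule that[of "Max (N ` T)"])
    fix x F assume x: "x \<in> V" and F: "finite F" "F \<subseteq> I"
    obtain y \<gamma> \<sigma> where y: "y \<in> T" "symmetry \<gamma> \<sigma>" "x = \<gamma> y" using orbits[OF x] by blast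
    have "F \<subseteq> \<sigma> ` I" using F y by (simp add: symmetry_def bij_betw_def)
    then obtain G where G: "G \<subseteq> I" "finite G" "F = \<sigma> ` G"
      using F by (metis finite_subset_image)
    have "N y \<le> Max (N ` T)" using T y by auto
    then have "bern_expect p F (\<lambda>A. of_bool (Max (N ` T) \<le> card (reach R A {x})))
      \<le> bern_expect p F (\<lambda>A. of_bool (N y \<le> card (reach R A {x})))"
      using p by (intro bern_expect_mono) auto
    also have "\<dots> = bern_expect p G (\<lambda>A. of_bool (N y \<le> card (reach R A {y})))"
      using tail_symmetry[OF y(2), of y G] G y T by auto
    also have "\<dots> \<le> \<epsilon>" using N y G by blast
    finally show "bern_expect p F (\<lambda>A. of_bool (Max (N ` T) \<le> card (reach R A {x}))) \<le> \<epsilon>" .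
  qed
qed

text \<open>A cluster with fewer than \<open>N\<close> vertices has weight at least \<open>w ^ N\<close>, and
  \<open>w ^ N\<close> tends to 1 as \<open>w\<close> increases to 1. Requiring tails of at most \<open>(1 - c) / 2\<close> leaves
  room above \<open>c\<close>.\<close>
lemma weight_lower_bound:
  assumes p: "0 \<le> p" "p \<le> 1" and c: "0 < c" "c < 1"
    and tail: "\<And>x F. x \<in> V \<Longrightarrow> finite F \<Longrightarrow> F \<subseteq> I \<Longrightarrow>
     bern_expect p F (\<lambda>A. of_bool (N \<le> card (reach R A {x}))) \<le> (1 - c) / 2"
  obtains w where "0 < w" "w < 1" "\<And>x F. x \<in> V \<Longrightarrow> finite F \<Longrightarrow> F \<subseteq> I \<Longrightarrow>
     c \<le> bern_expect p F (\<lambda>A. w ^ card (reach R A {x}))"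
proof -
  have "((\<lambda>w. w ^ N * (1 + c) / 2) \<longlongrightarrow> 1 ^ N * (1 + c) / 2) (at_left (1::real))"
    by (intro tendsto_intros) auto
  moreover have "c < 1 ^ N * (1 + c) / 2" using c by simp
  ultimately have "eventually (\<lambda>w. c < w ^ N * (1 + c) / 2) (at_left (1::real))"
    by (rule order_tendstoD)
  moreover have "eventually (\<lambda>w. 0 < w \<and> w < 1) (at_left (1::real))"
    using eventually_at_left_real[of 0 1] by (auto elim: eventually_mono)
  ultimately have "eventually (\<lambda>w. c < w ^ N * (1 + c) / 2 \<and> 0 < w \<and> w < 1) (at_left (1::real))"
    by (rule eventually_conj)
  then obtain w where w: "c < w ^ N * (1 + c) / 2" "0 < w" "w < 1"
    using eventually_happens'[OF trivial_limit_at_left_real] by blast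
  have "c \<le> bern_expect p F (\<lambda>A. w ^ card (reach R A {x}))" if x: "x \<in> V" "finite F" "F \<subseteq> I" for x F
  proof -
    have "c \<le> w ^ N * (1 - (1 - c) / 2)" using w by (simp add: field_simps)
    also have "\<dots> \<le> w ^ N * (1 - bern_expect p F (\<lambda>A. of_bool (N \<le> card (reach R A {x}))))"
      using tail[OF x] w by (intro mult_left_mono) auto
    also have "\<dots> = bern_expect p F (\<lambda>A. w ^ N * (1 - of_bool (N \<le> card (reach R A {x}))))"
      by (simp add: bern_expect_scale bern_expect_diff bern_expect_const[OF x(2)])
    also have "\<dots> \<le> bern_expect p F (\<lambda>A. w ^ card (reach R A {x}))"
      using w by (intro bern_expect_mono p) (auto simp: power_decreasing)
    finally show ?thesis .
  qed
  then show thesis using that w by blast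
qed

section \<open>From finite families to the infinite product measure\<close>

lemma cluster_size_ge_iff:
  assumes "A \<subseteq> I"
  shows "enat n \<le> cluster_size (reach R A {x}) \<longleftrightarrow> (\<exists>F. finite F \<and> F \<subseteq> A \<and> n \<le> card (reach R F {x}))"
proof
  assume n: "enat n \<le> cluster_size (reach R A {x})"
  have "\<exists>B. finite B \<and> card B = n \<and> B \<subseteq> reach R A {x}"
  proof (cases "finite (reach R A {x})")
    case True
    then show ?thesis using n obtain_subset_with_card_n[of n "reach R A {x}"]
      by (metis cluster_size_def enat_ord_simps(1) finite_subset)
  next
    case False
    then show ?thesis using infinite_arbitrarily_large by metis
  qed
  then obtain B where B: "finite B" "card B = n" "B \<subseteq> reach R A {x}" by blast
  obtain F where F: "finite F" "F \<subseteq> A" "B \<subseteq> reach R F {x}"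
    using reach_finite_witness[OF B(1,3)] .
  then have "n \<le> card (reach R F {x})"
    using B assms by (metis card_mono finite.emptyI finite.insertI finite_reach subset_trans)
  then show "\<exists>F. finite F \<and> F \<subseteq> A \<and> n \<le> card (reach R F {x})" using F by blast
next
  assume "\<exists>F. finite F \<and> F \<subseteq> A \<and> n \<le> card (reach R F {x})"
  then obtain F where F: "finite F" "F \<subseteq> A" "n \<le> card (reach R F {x})" by blast
  then have "reach R F {x} \<subseteq> reach R A {x}" by (intro reach_mono) auto
  then show "enat n \<le> cluster_size (reach R A {x})"
    using F(3) card_mono[of "reach R A {x}" "reach R F {x}"] by (auto simp: cluster_size_def)
qed

abbreviation open_reach :: "('i \<Rightarrow> bool) \<Rightarrow> 'a \<Rightarrow> 'a set" where
  "open_reach \<omega> x \<equiv> reach R {i \<in> I. \<omega> i} {x}"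

lemma prob_space_percolation: "prob_space (percolation_measure I p)"
  unfolding percolation_measure_def by (intro prob_space_PiM prob_space_measure_pmf)

lemma tail_event_eq:
  "{\<omega> \<in> space (percolation_measure I p). enat n \<le> cluster_size (open_reach \<omega> x)}
   = (\<Union>F\<in>{F. finite F \<and> F \<subseteq> I}. {\<omega> \<in> space (percolation_measure I p). n \<le> card (reach R {i \<in> F. \<omega> i} {x})})"
proof -
  have "(\<exists>G. finite G \<and> G \<subseteq> {i \<in> I. \<omega> i} \<and> n \<le> card (reach R G {x}))
    \<longleftrightarrow> (\<exists>F. finite F \<and> F \<subseteq> I \<and> n \<le> card (reach R {i \<in> F. \<omega> i} {x}))" for \<omega>
  proof
    assume "\<exists>G. finite G \<and> G \<subseteq> {i \<in> I. \<omega> i} \<and> n \<le> card (reach R G {x})"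
    then obtain G where G: "finite G" "G \<subseteq> {i \<in> I. \<omega> i}" "n \<le> card (reach R G {x})" by blast
    then have "{i \<in> G. \<omega> i} = G" by blast
    then show "\<exists>F. finite F \<and> F \<subseteq> I \<and> n \<le> card (reach R {i \<in> F. \<omega> i} {x})" using G by (intro exI[of _ G]) auto
  next
    assume "\<exists>F. finite F \<and> F \<subseteq> I \<and> n \<le> card (reach R {i \<in> F. \<omega> i} {x})"
    then obtain F where "finite F" "F \<subseteq> I" "n \<le> card (reach R {i \<in> F. \<omega> i} {x})" by blast
    then show "\<exists>G. finite G \<and> G \<subseteq> {i \<in> I. \<omega> i} \<and> n \<le> card (reach R G {x})"
      by (intro exI[of _ "{i \<in> F. \<omega> i}"]) auto
  qed
  moreover have "{i \<in> I. \<omega> i} \<subseteq> I" for \<omega> by blast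
  ultimately have "enat n \<le> cluster_size (open_reach \<omega> x)
    \<longleftrightarrow> (\<exists>F. finite F \<and> F \<subseteq> I \<and> n \<le> card (reach R {i \<in> F. \<omega> i} {x}))" for \<omega>
    by (simp only: cluster_size_ge_iff)
  then show ?thesis by blast
qed

lemma tail_event_sets:
  assumes "p \<in> {0..1}"
  shows "{\<omega> \<in> space (percolation_measure I p). enat n \<le> cluster_size (open_reach \<omega> x)}
    \<in> sets (percolation_measure I p)"
proof -
  have "countable {F. finite F \<and> F \<subseteq> I}"
    by (rule countable_Collect_finite_subset[OF countable_items])
  moreover have "{\<omega> \<in> space (percolation_measure I p). n \<le> card (reach R {i \<in> F. \<omega> i} {x})}
      \<in> sets (percolation_measure I p)" if "F \<in> {F. finite F \<and> F \<subseteq> I}" for F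
    using that by (intro prob_percolation_finite(2)[OF assms, where Q = "\<lambda>A. n \<le> card (reach R A {x})"]) auto
  ultimately show ?thesis unfolding tail_event_eq by (intro sets.countable_UN') auto
qed

lemma infinite_event_eq:
  "{\<omega> \<in> space (percolation_measure I p). cluster_size (open_reach \<omega> x) = \<infinity>}
   = (\<Inter>n. {\<omega> \<in> space (percolation_measure I p). enat n \<le> cluster_size (open_reach \<omega> x)})"
proof -
  have "c = \<infinity>" if "\<And>n. enat n \<le> c" for c
    using that[of "Suc (the_enat c)"] by (cases c) auto
  then show ?thesis by auto
qed

lemma infinite_event_sets:
  assumes "p \<in> {0..1}"
  shows "{\<omega> \<in> space (percolation_measure I p). cluster_size (open_reach \<omega> x) = \<infinity>}
    \<in> sets (percolation_measure I p)"
  unfolding infinite_event_eq using tail_event_sets[OF assms] by (intro sets.countable_INT) auto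

text \<open>Exhausting the countable set of items by finite ones, the events that the cluster within
  these has size at least \<open>n\<close> increase to the event for the full cluster.\<close>
lemma tail_prob_le:
  assumes p: "p \<in> {0..1}"
    and t: "\<And>F. finite F \<Longrightarrow> F \<subseteq> I \<Longrightarrow> bern_expect p F (\<lambda>A. of_bool (n \<le> card (reach R A {x}))) \<le> t"
  shows "\<P>(\<omega> in percolation_measure I p. enat n \<le> cluster_size (open_reach \<omega> x)) \<le> t"
proof -
  let ?M = "percolation_measure I p"
  interpret prob_space ?M by (rule prob_space_percolation)
  define F where "F k = {i \<in> I. to_nat_on I i \<le> k}" for k
  have inj: "inj_on (to_nat_on I) I" by (rule inj_on_to_nat_on[OF countable_items])
  have F: "finite (F k)" "F k \<subseteq> I" for k
  proof -
    show sub: "F k \<subseteq> I" by (auto simp: F_def)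
    have "finite (to_nat_on I ` F k)" by (rule finite_subset[of _ "{..k}"]) (auto simp: F_def)
    then show "finite (F k)" using sub inj by (metis finite_imageD inj_on_subset)
  qed
  define X where "X k = {\<omega> \<in> space ?M. n \<le> card (reach R {i \<in> F k. \<omega> i} {x})}" for k
  have X: "X k \<in> sets ?M" "measure ?M (X k) \<le> t" for k
    using prob_percolation_finite[OF p F, of "\<lambda>A. n \<le> card (reach R A {x})" k] t[OF F] by (auto simp: X_def)
  have mono: "card (reach R {i \<in> G. \<omega> i} {x}) \<le> card (reach R {i \<in> F k. \<omega> i} {x})" if "G \<subseteq> F k" for G k \<omega>
    using that F[of k] by (intro card_reach_mono[of _ _ "F k"]) auto
  have "incseq X"
  proof (rule incseq_SucI)
    fix k
    have "F k \<subseteq> F (Suc k)" by (auto simp: F_def)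
    from mono[OF this] show "X k \<le> X (Suc k)" by (auto simp: X_def intro: order_trans)
  qed
  then have "(\<lambda>k. measure ?M (X k)) \<longlonglongrightarrow> measure ?M (\<Union>k. X k)"
    using X by (intro finite_Lim_measure_incseq) auto
  then have "measure ?M (\<Union>k. X k) \<le> t"
    by (rule LIMSEQ_le_const2) (use X in auto)
  moreover have "{\<omega> \<in> space ?M. enat n \<le> cluster_size (open_reach \<omega> x)} = (\<Union>k. X k)"
  proof -
    have "\<exists>k. G \<subseteq> F k" if "finite G" "G \<subseteq> I" for G
      using that by (intro exI[of _ "Max (to_nat_on I ` G)"]) (auto simp: F_def)
    then have "(\<exists>G. finite G \<and> G \<subseteq> I \<and> n \<le> card (reach R {i \<in> G. \<omega> i} {x}))
      \<longleftrightarrow> (\<exists>k. n \<le> card (reach R {i \<in> F k. \<omega> i} {x}))" for \<omega>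
      using F mono by (meson order_trans)
    then show ?thesis
      unfolding tail_event_eq X_def by blast
  qed
  ultimately show ?thesis by simp
qed

text \<open>The clause \<open>\<omega> i\<close> serves site percolation, where an infinite cluster at \<open>x\<close> also
  requires \<open>x\<close> itself to be open, whereas \<open>open_reach\<close> ignores the state of its starting point.
  For bonds any edge may be taken for \<open>i\<close>.\<close>
lemma tight_if_not_percolating:
  assumes p: "0 < p" "p \<le> 1" and i: "i \<in> I"
    and null: "\<P>(\<omega> in percolation_measure I p. \<omega> i \<and> cluster_size (open_reach \<omega> x) = \<infinity>) = 0"
  shows "tight p x"
  unfolding tight_def
proof (intro allI impI)
  fix \<epsilon> :: real assume "0 < \<epsilon>"
  let ?M = "percolation_measure I p"
  interpret prob_space ?M by (rule prob_space_percolation)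
  have p01: "p \<in> {0..1}" using p by auto
  define X where "X n = {\<omega> \<in> space ?M. \<omega> i \<and> enat n \<le> cluster_size (open_reach \<omega> x)}" for n
  have "{\<omega> \<in> space ?M. i \<in> {j \<in> {i}. \<omega> j}} \<in> sets ?M"
    using i by (intro prob_percolation_finite(2)[OF p01, where Q = "\<lambda>A. i \<in> A"]) auto
  then have "{\<omega> \<in> space ?M. i \<in> {j \<in> {i}. \<omega> j}} \<inter> {\<omega> \<in> space ?M. enat n \<le> cluster_size (open_reach \<omega> x)} \<in> sets ?M" for n
    using tail_event_sets[OF p01] by (intro sets.Int)
  also have "{\<omega> \<in> space ?M. i \<in> {j \<in> {i}. \<omega> j}} \<inter> {\<omega> \<in> space ?M. enat n \<le> cluster_size (open_reach \<omega> x)} = X n" for n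
    by (auto simp: X_def)
  finally have X: "X n \<in> sets ?M" for n .
  have "decseq X"
    unfolding decseq_def X_def by (auto intro: order_trans[rotated])
  then have "(\<lambda>n. measure ?M (X n)) \<longlonglongrightarrow> measure ?M (\<Inter>n. X n)"
    using X by (intro finite_Lim_measure_decseq) auto
  moreover have "(\<Inter>n. X n) = {\<omega> \<in> space ?M. \<omega> i \<and> cluster_size (open_reach \<omega> x) = \<infinity>}"
    using infinite_event_eq[of p x] unfolding X_def by blast
  ultimately have "(\<lambda>n. measure ?M (X n)) \<longlonglongrightarrow> 0" using null by simp
  moreover have "0 < p * \<epsilon>" using p \<open>0 < \<epsilon>\<close> by simp
  ultimately have "eventually (\<lambda>n. measure ?M (X n) < p * \<epsilon>) sequentially"
    by (rule order_tendstoD)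
  then obtain N where N: "measure ?M (X N) < p * \<epsilon>" by (auto dest: eventually_happens)
  have "bern_expect p F (\<lambda>A. of_bool (N \<le> card (reach R A {x}))) \<le> \<epsilon>" if F: "finite F" "F \<subseteq> I" for F
  proof -
    have F': "finite (insert i F)" "insert i F \<subseteq> I" using F i by auto
    have "p * bern_expect p F (\<lambda>A. of_bool (N \<le> card (reach R A {x})))
      \<le> bern_expect p (insert i F) (\<lambda>A. of_bool (i \<in> A) * of_bool (N \<le> card (reach R A {x})))"
      using p F F' by (intro bern_expect_forced_open tail_mono_in_items[OF _ _ F']) auto
    also have "\<dots> = bern_expect p (insert i F) (\<lambda>A. of_bool (i \<in> A \<and> N \<le> card (reach R A {x})))"
      by (simp add: of_bool_conj)
    also have "\<dots> = measure ?M {\<omega> \<in> space ?M. i \<in> {j \<in> insert i F. \<omega> j} \<and> N \<le> card (reach R {j \<in> insert i F. \<omega> j} {x})}"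
      using prob_percolation_finite(1)[OF p01 F', of "\<lambda>A. i \<in> A \<and> N \<le> card (reach R A {x})"] by simp
    also have "\<dots> \<le> measure ?M (X N)"
    proof (intro finite_measure_mono[OF _ X] subsetI)
      fix \<omega> assume "\<omega> \<in> {\<omega> \<in> space ?M. i \<in> {j \<in> insert i F. \<omega> j} \<and> N \<le> card (reach R {j \<in> insert i F. \<omega> j} {x})}"
      then have \<omega>: "\<omega> \<in> space ?M" "\<omega> i" "N \<le> card (reach R {j \<in> insert i F. \<omega> j} {x})" by auto
      then have "\<omega> \<in> {\<omega> \<in> space ?M. enat N \<le> cluster_size (open_reach \<omega> x)}"
        unfolding tail_event_eq using F' by blast
      then show "\<omega> \<in> X N" using \<omega> by (simp add: X_def)
    qed
    finally have "p * bern_expect p F (\<lambda>A. of_bool (N \<le> card (reach R A {x}))) \<le> p * \<epsilon>" using N by simp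
    then show ?thesis using p by simp
  qed
  then show "\<exists>N. \<forall>F. finite F \<longrightarrow> F \<subseteq> I \<longrightarrow>
     bern_expect p F (\<lambda>A. of_bool (N \<le> card (reach R A {x}))) \<le> \<epsilon>" by blast
qed

text \<open>This shows that the supremum defining a threshold is taken over a nonempty set. The
  supremum of the empty set of reals would be an unspecified number.\<close>
lemma not_percolating_at_0:
  assumes "\<And>\<omega>. Q \<omega> \<Longrightarrow> cluster_size (open_reach \<omega> x) = \<infinity>"
  shows "\<P>(\<omega> in percolation_measure I 0. Q \<omega>) = 0"
proof -
  interpret prob_space "percolation_measure I 0" by (rule prob_space_percolation)
  have "\<P>(\<omega> in percolation_measure I 0. Q \<omega>)
    \<le> \<P>(\<omega> in percolation_measure I 0. enat 2 \<le> cluster_size (open_reach \<omega> x))"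
    using assms by (intro finite_measure_mono tail_event_sets) auto
  also have "\<dots> \<le> 0"
    by (intro tail_prob_le) (auto simp: bern_expect_0)
  finally show ?thesis using measure_le_0_iff by blast
qed

text \<open>The lower bound \<open>c\<close> on the expected weights is exported along with the decay, because it
  also controls the degrees in bond percolation.\<close>
lemma exponential_decay:
  assumes q: "0 \<le> q" "q < p" and p: "p \<le> 1" and T: "finite T" "T \<subseteq> V"
    and orbits: "\<And>x. x \<in> V \<Longrightarrow> \<exists>y\<in>T. \<exists>\<gamma> \<sigma>. symmetry \<gamma> \<sigma> \<and> x = \<gamma> y"
    and conn: "\<And>y. y \<in> V \<Longrightarrow> (x0, y) \<in> (\<Union>i\<in>I. R i)\<^sup>*" and t: "tight p x0"
  obtains w c where "0 < w" "w < 1" "0 < c"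
    "\<And>x F. x \<in> V \<Longrightarrow> finite F \<Longrightarrow> F \<subseteq> I \<Longrightarrow> c \<le> bern_expect p F (\<lambda>A. w ^ card (reach R A {x}))"
    "\<And>x n. x \<in> V \<Longrightarrow> \<P>(\<omega> in percolation_measure I q. enat n \<le> cluster_size (open_reach \<omega> x)) \<le> w ^ n / c"
proof -
  \<comment> \<open>Any \<open>c\<close> with \<open>q / p \<le> c < 1\<close> serves; the midpoint is also positive when \<open>q = 0\<close>.\<close>
  define c where "c = (1 + q / p) / 2"
  have "0 < p" using q by simp
  have c: "0 < c" "c < 1" "q \<le> p * c"
    using q by (auto simp: c_def field_simps intro!: add_pos_nonneg)
  have "0 < (1 - c) / 2" using c by simp
  then obtain N where "\<And>x F. x \<in> V \<Longrightarrow> finite F \<Longrightarrow> F \<subseteq> I \<Longrightarrow>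
     bern_expect p F (\<lambda>A. of_bool (N \<le> card (reach R A {x}))) \<le> (1 - c) / 2"
    using uniform_tail[OF \<open>0 < p\<close> p _ T orbits conn t] by blast
  then obtain w where w: "0 < w" "w < 1" "\<And>x F. x \<in> V \<Longrightarrow> finite F \<Longrightarrow> F \<subseteq> I \<Longrightarrow>
     c \<le> bern_expect p F (\<lambda>A. w ^ card (reach R A {x}))"
    using weight_lower_bound[of p c N] \<open>0 < p\<close> p c by (metis less_eq_real_def)
  have "\<P>(\<omega> in percolation_measure I q. enat n \<le> cluster_size (open_reach \<omega> x)) \<le> w ^ n / c" if "x \<in> V" for x n
  proof (rule tail_prob_le)
    show "bern_expect q F (\<lambda>A. of_bool (n \<le> card (reach R A {x}))) \<le> w ^ n / c" if "finite F" "F \<subseteq> I" for F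
      using that \<open>x \<in> V\<close> \<open>0 < p\<close> p q c w by (intro finite_tail_bound[where p = p]) auto
  qed (use p q in auto)
  then show thesis using that w c by blast
qed

end

text \<open>For large \<open>n\<close> half of the decay of \<open>w ^ n\<close> compensates \<open>1 / c\<close>; for the
  remaining finitely many \<open>n\<close> the bound \<open>s < 1\<close> suffices for a small rate.\<close>
lemma uniform_rate:
  fixes w c s :: real
  assumes w: "0 < w" "w < 1" and c: "0 < c" and s: "s < 1"
  obtains \<alpha> where "0 < \<alpha>" "\<And>n t. t \<le> w ^ n / c \<Longrightarrow> t \<le> s \<Longrightarrow> t \<le> exp (- \<alpha> * real n)"
proof -
  define v u where "v = sqrt w" and "u = max s (1 / 2)"
  have v: "0 < v" "v < 1" "w = v * v" using w by (auto simp: v_def)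
  have u: "0 < u" "u < 1" "s \<le> u" using s by (auto simp: u_def)
  obtain N where N: "v ^ N < c" using real_arch_pow_inv[OF c v(2)] by blast
  define \<alpha> where "\<alpha> = min (- ln v) (- ln u / real (Suc N))"
  have \<alpha>: "0 < \<alpha>" using u v by (auto simp: \<alpha>_def divide_pos_pos ln_less_zero divide_neg_pos)
  moreover have "t \<le> exp (- \<alpha> * real n)" if t: "t \<le> w ^ n / c" "t \<le> s" for n t
  proof (cases "N \<le> n")
    case True
    then have "v ^ n \<le> v ^ N" using v by (intro power_decreasing) auto
    then have "v ^ n \<le> c" using N by simp
    then have "v ^ n * v ^ n \<le> c * v ^ n" using v by (intro mult_right_mono) auto
    then have "w ^ n / c \<le> v ^ n" using c v(3) by (simp add: field_simps power_mult_distrib)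
    also have "v ^ n = exp (ln v * real n)" using v by (simp add: exp_of_nat2_mult)
    also have "\<dots> \<le> exp (- \<alpha> * real n)"
    proof -
      have "ln v \<le> - \<alpha>" by (simp add: \<alpha>_def)
      then show ?thesis by (simp only: exp_le_cancel_iff) (intro mult_right_mono, auto)
    qed
    finally show ?thesis using t by simp
  next
    case False
    have "\<alpha> * real n \<le> (- ln u / real (Suc N)) * real (Suc N)"
      using False \<alpha> by (intro mult_mono) (auto simp: \<alpha>_def)
    then have "ln u \<le> - \<alpha> * real n" by simp
    then have "u \<le> exp (- \<alpha> * real n)" using u by (metis exp_le_cancel_iff exp_ln)
    then show ?thesis using t u by simp
  qed
  ultimately show thesis using that by blast
qed

section \<open>Bond and site percolation as instances\<close>

definition bond_step :: "'a set \<Rightarrow> 'a rel" where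
  "bond_step e = {(u, v). {u, v} = e}"

definition site_step :: "'a set set \<Rightarrow> 'a \<Rightarrow> 'a rel" where
  "site_step E v = {(u, v') | u v'. v' = v \<and> {u, v} \<in> E}"

lemma simple_graph_edge:
  assumes "simple_graph V E" "e \<in> E"
  obtains u v where "e = {u, v}" "u \<in> V" "v \<in> V" "u \<noteq> v"
  using assms unfolding simple_graph_def by (metis card_2_iff insert_subset)

lemma countable_edges:
  assumes "simple_graph V E" "countable V"
  shows "countable E"
proof (rule countable_subset)
  show "E \<subseteq> {A. finite A \<and> A \<subseteq> V}"
    using assms(1) simple_graph_edge by (auto simp: simple_graph_def card_ge_0_finite)
  show "countable {A. finite A \<and> A \<subseteq> V}" using assms(2) by (rule countable_Collect_finite_subset)
qed

lemma spread_bond: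
  assumes "simple_graph V E" "countable V"
  shows "spread E bond_step V"
proof
  show "countable E" using assms by (rule countable_edges)
  show "bond_step e \<subseteq> V \<times> V" if "e \<in> E" for e
    using assms(1) that by (auto simp: bond_step_def simple_graph_def)
  show "Range (bond_step e) \<subseteq> {x, y}" if "(x, y) \<in> bond_step e" for e x y
    using that by (auto simp: bond_step_def)
qed

lemma spread_site:
  assumes "simple_graph V E" "countable V"
  shows "spread V (site_step E) V"
proof
  show "site_step E v \<subseteq> V \<times> V" if "v \<in> V" for v
    using assms(1) that by (auto simp: site_step_def simple_graph_def)
qed (use assms in \<open>auto simp: site_step_def\<close>)

lemma UN_bond_step: "(\<Union>e\<in>A. bond_step e) = graph_adj A"
  by (auto simp: bond_step_def graph_adj_def)

lemma UN_site_step: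
  assumes "simple_graph V E"
  shows "(\<Union>v\<in>V. site_step E v) = graph_adj E"
  using assms by (auto simp: site_step_def graph_adj_def simple_graph_def)

lemma bond_cluster_eq_reach:
  assumes "x \<in> V"
  shows "bond_cluster V E \<omega> x = reach bond_step {e \<in> E. \<omega> e} {x}"
  using assms by (auto simp: bond_cluster_def component_def reach_def UN_bond_step)

text \<open>Steps of \<open>site_step\<close> only test the endpoint that they enter. Starting from an open vertex,
  every later starting point of a step has already been entered, so all vertices of a path are open.\<close>
lemma site_cluster_eq_reach:
  assumes "simple_graph V E" "x \<in> V" "\<omega> x"
  shows "site_cluster V E \<omega> x = reach (site_step E) {v \<in> V. \<omega> v} {x}"
proof -
  let ?A = "graph_adj {e \<in> E. \<forall>v\<in>e. \<omega> v}" and ?B = "\<Union>v\<in>{v \<in> V. \<omega> v}. site_step E v"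
  have "(x, y) \<in> ?B\<^sup>*" if "(x, y) \<in> ?A\<^sup>*" for y
  proof -
    have "?A \<subseteq> ?B"
      using assms(1) by (auto simp: graph_adj_def site_step_def simple_graph_def)
    then show ?thesis using that rtrancl_mono by blast
  qed
  moreover have "(x, y) \<in> ?A\<^sup>* \<and> \<omega> y" if "(x, y) \<in> ?B\<^sup>*" for y
    using that
  proof (induction rule: rtrancl_induct)
    case (step y z)
    then have "(y, z) \<in> ?A" "\<omega> z" by (auto simp: graph_adj_def site_step_def)
    then show ?case using step.IH by (meson rtrancl.rtrancl_into_rtrancl)
  qed (use assms in simp)
  ultimately have "(x, y) \<in> ?A\<^sup>* \<longleftrightarrow> (x, y) \<in> ?B\<^sup>*" for y by blast
  then show ?thesis
    using assms(2,3) unfolding site_cluster_def component_def reach_def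
    by (simp only: Image_singleton mem_Collect_eq simp_thms)
qed

lemma site_cluster_closed: "\<not> \<omega> x \<Longrightarrow> site_cluster V E \<omega> x = {}"
  by (simp add: site_cluster_def component_def)

lemma symmetry_bond:
  assumes "simple_graph V E" "countable V" "\<gamma> \<in> graph_aut V E"
  shows "spread.symmetry E bond_step V \<gamma> ((`) \<gamma>)"
proof -
  interpret spread E bond_step V by (rule spread_bond[OF assms(1,2)])
  have bij: "bij_betw \<gamma> V V" and edge: "\<And>u v. u \<in> V \<Longrightarrow> v \<in> V \<Longrightarrow> {\<gamma> u, \<gamma> v} \<in> E \<longleftrightarrow> {u, v} \<in> E"
    using assms(3) by (auto simp: graph_aut_def)
  have inj: "inj_on \<gamma> V" and surj: "\<gamma> ` V = V" using bij by (auto simp: bij_betw_def)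
  have sub: "e \<subseteq> V" if "e \<in> E" for e using assms(1) that by (simp add: simple_graph_def)
  have "inj_on ((`) \<gamma>) E"
    using inj sub by (meson inj_onI inj_on_image_eq_iff)
  moreover have "(`) \<gamma> ` E = E"
  proof (intro antisym subsetI)
    fix e assume "e \<in> (`) \<gamma> ` E"
    then obtain e' where "e' \<in> E" "e = \<gamma> ` e'" by blast
    moreover obtain u v where "e' = {u, v}" "u \<in> V" "v \<in> V"
      using simple_graph_edge[OF assms(1) \<open>e' \<in> E\<close>] by metis
    ultimately show "e \<in> E" using edge[of u v] by simp
  next
    fix e assume "e \<in> E"
    obtain u v where uv: "e = {u, v}" "u \<in> V" "v \<in> V"
      using simple_graph_edge[OF assms(1) \<open>e \<in> E\<close>] by metis
    then obtain u' v' where "u' \<in> V" "v' \<in> V" "u = \<gamma> u'" "v = \<gamma> v'"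
      using surj by (metis imageE)
    then show "e \<in> (`) \<gamma> ` E"
      using edge[of u' v'] uv \<open>e \<in> E\<close> by (intro image_eqI[of _ _ "{u', v'}"]) auto
  qed
  ultimately have "bij_betw ((`) \<gamma>) E E" by (simp add: bij_betw_def)
  moreover have "{\<gamma> u, \<gamma> v} = \<gamma> ` e \<longleftrightarrow> {u, v} = e" if "e \<in> E" "u \<in> V" "v \<in> V" for e u v
    using inj_on_image_eq_iff[OF inj, of "{u, v}" e] sub that by simp
  ultimately show ?thesis
    using bij by (auto simp: symmetry_def bond_step_def)
qed

lemma symmetry_site:
  assumes "simple_graph V E" "countable V" "\<gamma> \<in> graph_aut V E"
  shows "spread.symmetry V (site_step E) V \<gamma> \<gamma>"
proof -
  interpret spread V "site_step E" V by (rule spread_site[OF assms(1,2)])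
  have "inj_on \<gamma> V" using assms(3) by (auto simp: graph_aut_def bij_betw_def)
  then show ?thesis
    using assms(3) by (auto simp: symmetry_def graph_aut_def site_step_def dest: inj_onD)
qed

lemma below_Sup_threshold:
  fixes P :: "real \<Rightarrow> bool"
  assumes "p < Sup {q \<in> {0..1}. P q}" "P 0"
  obtains q where "p < q" "q \<le> 1" "P q"
proof -
  have "0 \<in> {q \<in> {0..1}. P q}" using assms(2) by simp
  then have "{q \<in> {0..1}. P q} \<noteq> {}" by blast
  then show thesis using less_cSupE[OF assms(1)] that by auto
qed

text \<open>Each open edge at \<open>x\<close> contributes its own neighbour to the cluster, so the expected
  weight is exponentially small in the degree.\<close>
lemma bond_degree_bound:
  assumes G: "simple_graph V E" "countable V" and p: "0 \<le> p" "p \<le> 1" and w: "0 \<le> w" "w \<le> 1"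
    and F: "finite F" "F \<subseteq> E" "\<And>e. e \<in> F \<Longrightarrow> x \<in> e"
  shows "bern_expect p F (\<lambda>A. w ^ card (reach bond_step A {x})) \<le> (1 - p + p * w) ^ card F"
proof -
  interpret spread E bond_step V by (rule spread_bond[OF G])
  have "\<exists>y. e = {x, y}" if "e \<in> F" for e
  proof -
    have "e \<in> E" using F that by blast
    obtain u v where "e = {u, v}" using simple_graph_edge[OF G(1) \<open>e \<in> E\<close>] by metis
    then show ?thesis using F(3)[OF that] by (auto simp: insert_commute)
  qed
  then obtain h where h: "\<And>e. e \<in> F \<Longrightarrow> e = {x, h e}" by metis
  have "card A \<le> card (reach bond_step A {x})" if A: "A \<subseteq> F" for A
  proof (rule card_inj_on_le)
    show "inj_on h A" using h A by (metis inj_onI subsetD)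
    show "h ` A \<subseteq> reach bond_step A {x}"
    proof safe
      fix e assume "e \<in> A"
      then have "(x, h e) \<in> bond_step e" using h A by (auto simp: bond_step_def)
      then show "h e \<in> reach bond_step A {x}"
        using reach_step[of x bond_step A "{x}" e "h e"] \<open>e \<in> A\<close> reach_refl[of "{x}" bond_step A] by blast
    qed
    show "finite (reach bond_step A {x})"
      using A F by (intro finite_reach) (auto intro: finite_subset)
  qed
  then have "bern_expect p F (\<lambda>A. w ^ card (reach bond_step A {x})) \<le> bern_expect p F (\<lambda>A. w ^ card (A \<inter> F))"
    using w by (intro bern_expect_mono p power_decreasing) (auto simp: Int_absorb2)
  then show ?thesis using bern_expect_power_card[OF F(1) order_refl] by simp
qed

text \<open>A bond cluster with at least two vertices needs an open edge at its base vertex.\<close>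
lemma bond_not_isolated_prob:
  assumes G: "simple_graph V E" "countable V" and q: "0 \<le> q" "q \<le> 1" and F: "finite F" "F \<subseteq> E"
  shows "bern_expect q F (\<lambda>A. of_bool (2 \<le> card (reach bond_step A {x}))) \<le> 1 - (1 - q) ^ card {e \<in> F. x \<in> e}"
proof -
  let ?S = "{e \<in> F. x \<in> e}"
  have "bern_expect q F (\<lambda>A. of_bool (2 \<le> card (reach bond_step A {x})))
    \<le> bern_expect q F (\<lambda>A. 1 - 0 ^ card (A \<inter> ?S))"
  proof (intro bern_expect_mono q)
    fix A assume A: "A \<subseteq> F"
    show "(of_bool (2 \<le> card (reach bond_step A {x})) :: real) \<le> 1 - 0 ^ card (A \<inter> ?S)"
    proof (cases "A \<inter> ?S = {}")
      case True
      then have "reach bond_step A {x} \<subseteq> {x}"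
        using A by (intro reach_closed) (auto simp: bond_step_def)
      then have "card (reach bond_step A {x}) \<le> 1"
        using card_mono[of "{x}"] by simp
      then show ?thesis by (simp add: power_le_one)
    next
      case False
      then have "card (A \<inter> ?S) \<noteq> 0" using A F by (auto simp: finite_subset)
      then show ?thesis by (auto simp: power_0_left)
    qed
  qed
  also have "\<dots> = 1 - (1 - q) ^ card ?S"
    using bern_expect_power_card[OF F(1), of ?S q 0] by (simp add: bern_expect_diff bern_expect_const F)
  finally show ?thesis .
qed

section \<open>Exponential decay below the threshold\<close>

lemma bond_decay:
  assumes "simple_graph V E" "infinite V" "countable V" "connected_graph V E" "quasi_transitive V E"
    and "x\<^sub>0 \<in> V" "p \<in> {0..1}" and less: "p < bond_threshold V E x\<^sub>0"
  shows "\<exists>\<alpha>>0. \<forall>n\<ge>2. \<forall>x\<in>V.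
    \<P>(\<omega> in percolation_measure E p. cluster_size (bond_cluster V E \<omega> x) \<ge> enat n) \<le> exp (- \<alpha> * real n)"
proof -
  interpret spread E bond_step V by (rule spread_bond[OF assms(1,3)])
  have "\<P>(\<omega> in percolation_measure E 0. cluster_size (bond_cluster V E \<omega> x\<^sub>0) = \<infinity>) = 0"
    by (rule not_percolating_at_0[of _ x\<^sub>0]) (simp add: bond_cluster_eq_reach[OF assms(6)])
  then obtain p' where p': "p < p'" "p' \<le> 1"
    "\<P>(\<omega> in percolation_measure E p'. cluster_size (bond_cluster V E \<omega> x\<^sub>0) = \<infinity>) = 0"
    by (rule below_Sup_threshold[OF less[unfolded bond_threshold_def]])
  obtain e where e: "e \<in> E"
  proof -
    obtain y where y: "y \<in> V" "y \<noteq> x\<^sub>0"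
      using assms(2) by (metis finite.emptyI finite_insert finite_subset insertI1 subsetI)
    then have "(x\<^sub>0, y) \<in> (graph_adj E)\<^sup>*" using assms(4,6) by (simp add: connected_graph_def)
    then show thesis using that y by (auto simp: graph_adj_def elim: converse_rtranclE)
  qed
  interpret P': prob_space "percolation_measure E p'" by (rule prob_space_percolation)
  have "tight p' x\<^sub>0"
  proof (rule tight_if_not_percolating[OF _ p'(2) e])
    have "\<P>(\<omega> in percolation_measure E p'. \<omega> e \<and> cluster_size (open_reach \<omega> x\<^sub>0) = \<infinity>)
      \<le> \<P>(\<omega> in percolation_measure E p'. cluster_size (open_reach \<omega> x\<^sub>0) = \<infinity>)"
      using assms(7) p' by (intro P'.finite_measure_mono infinite_event_sets) auto
    then show "\<P>(\<omega> in percolation_measure E p'. \<omega> e \<and> cluster_size (open_reach \<omega> x\<^sub>0) = \<infinity>) = 0"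
      using p'(3) bond_cluster_eq_reach[OF assms(6)] by (simp add: measure_le_0_iff)
  qed (use p' assms(7) in simp)
  obtain T where T: "finite T" "T \<subseteq> V" "\<forall>x\<in>V. \<exists>y\<in>T. \<exists>\<gamma>\<in>graph_aut V E. x = \<gamma> y"
    using assms(5) by (auto simp: quasi_transitive_def)
  have conn: "(x\<^sub>0, y) \<in> (\<Union>e\<in>E. bond_step e)\<^sup>*" if "y \<in> V" for y
    using that assms(4,6) by (simp add: UN_bond_step connected_graph_def)
  have orbits: "\<exists>y\<in>T. \<exists>\<gamma> \<sigma>. symmetry \<gamma> \<sigma> \<and> x = \<gamma> y" if "x \<in> V" for x
    using T(3) that symmetry_bond[OF assms(1,3)] by blast
  have p0: "0 \<le> p" "p \<le> 1" "0 < p'" using assms(7) p' by auto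
  obtain w c where wc: "0 < w" "w < 1" "0 < c"
    "\<And>x F. x \<in> V \<Longrightarrow> finite F \<Longrightarrow> F \<subseteq> E \<Longrightarrow> c \<le> bern_expect p' F (\<lambda>A. w ^ card (reach bond_step A {x}))"
    "\<And>x n. x \<in> V \<Longrightarrow> \<P>(\<omega> in percolation_measure E p. enat n \<le> cluster_size (open_reach \<omega> x)) \<le> w ^ n / c"
    using exponential_decay[OF p0(1) p'(1,2) T(1,2) orbits conn \<open>tight p' x\<^sub>0\<close>] by blast
  have r: "0 \<le> 1 - p' + p' * w" "1 - p' + p' * w < 1"
    using p0 p' wc by (auto simp: mult_less_cancel_left1 add_nonneg_nonneg)
  obtain D where D: "(1 - p' + p' * w) ^ D < c"
    using real_arch_pow_inv[OF wc(3) r(2)] by blast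
  have deg: "card {e \<in> F. x \<in> e} \<le> D" if "x \<in> V" "finite F" "F \<subseteq> E" for x F
  proof (rule ccontr)
    let ?S = "{e \<in> F. x \<in> e}"
    assume "\<not> card ?S \<le> D"
    then have "(1 - p' + p' * w) ^ card ?S \<le> (1 - p' + p' * w) ^ D"
      using r by (intro power_decreasing) auto
    moreover have "c \<le> bern_expect p' ?S (\<lambda>A. w ^ card (reach bond_step A {x}))"
      using that by (intro wc) auto
    moreover have "\<dots> \<le> (1 - p' + p' * w) ^ card ?S"
      using that p0 p' wc by (intro bond_degree_bound[OF assms(1,3)]) auto
    ultimately show False using D by linarith
  qed
  have two: "\<P>(\<omega> in percolation_measure E p. enat 2 \<le> cluster_size (open_reach \<omega> x)) \<le> 1 - (1 - p) ^ D"
    if "x \<in> V" for x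
  proof (rule tail_prob_le[OF assms(7)])
    fix F assume F: "finite F" "F \<subseteq> E"
    have "(1 - p) ^ D \<le> (1 - p) ^ card {e \<in> F. x \<in> e}"
      using deg[OF that F] p0 by (intro power_decreasing) auto
    then show "bern_expect p F (\<lambda>A. of_bool (2 \<le> card (reach bond_step A {x}))) \<le> 1 - (1 - p) ^ D"
      using bond_not_isolated_prob[OF assms(1,3) p0(1,2) F, of x] by linarith
  qed
  have "1 - (1 - p) ^ D < 1" using p' by simp
  then obtain \<alpha> where \<alpha>: "0 < \<alpha>" "\<And>n t. t \<le> w ^ n / c \<Longrightarrow> t \<le> 1 - (1 - p) ^ D \<Longrightarrow> t \<le> exp (- \<alpha> * real n)"
    using uniform_rate[OF wc(1-3)] by blast
  interpret P: prob_space "percolation_measure E p" by (rule prob_space_percolation)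
  have "\<P>(\<omega> in percolation_measure E p. enat n \<le> cluster_size (open_reach \<omega> x)) \<le> exp (- \<alpha> * real n)"
    if n: "2 \<le> n" and x: "x \<in> V" for n x
  proof (rule \<alpha>(2)[OF wc(5)[OF x]])
    have "c \<ge> enat 2" if "c \<ge> enat n" for c using that n by (meson enat_ord_simps(1) order_trans)
    then have "\<P>(\<omega> in percolation_measure E p. enat n \<le> cluster_size (open_reach \<omega> x))
      \<le> \<P>(\<omega> in percolation_measure E p. enat 2 \<le> cluster_size (open_reach \<omega> x))"
      by (intro P.finite_measure_mono tail_event_sets assms(7)) auto
    then show "\<P>(\<omega> in percolation_measure E p. enat n \<le> cluster_size (open_reach \<omega> x)) \<le> 1 - (1 - p) ^ D"
      using two[OF x] by linarith
  qed
  then show ?thesis using \<alpha>(1) bond_cluster_eq_reach[where V = V and E = E] by (intro exI[of _ \<alpha>]) auto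
qed

lemma site_decay:
  assumes "simple_graph V E" "countable V" "connected_graph V E" "quasi_transitive V E"
    and "x\<^sub>0 \<in> V" "p \<in> {0..1}" and less: "p < site_threshold V E x\<^sub>0"
  shows "\<exists>\<alpha>>0. \<forall>n\<ge>1. \<forall>x\<in>V.
    \<P>(\<omega> in percolation_measure V p. cluster_size (site_cluster V E \<omega> x) \<ge> enat n) \<le> exp (- \<alpha> * real n)"
proof -
  interpret spread V "site_step E" V by (rule spread_site[OF assms(1,2)])
  have infinite_iff: "cluster_size (site_cluster V E \<omega> x\<^sub>0) = \<infinity> \<longleftrightarrow> \<omega> x\<^sub>0 \<and> cluster_size (open_reach \<omega> x\<^sub>0) = \<infinity>" for \<omega>
    using site_cluster_eq_reach[OF assms(1,5), of \<omega>] site_cluster_closed[of \<omega> x\<^sub>0 V E]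
    by (cases "\<omega> x\<^sub>0") (auto simp: cluster_size_def)
  have "\<P>(\<omega> in percolation_measure V 0. cluster_size (site_cluster V E \<omega> x\<^sub>0) = \<infinity>) = 0"
    by (rule not_percolating_at_0[of _ x\<^sub>0]) (simp add: infinite_iff)
  then obtain p' where p': "p < p'" "p' \<le> 1"
    "\<P>(\<omega> in percolation_measure V p'. cluster_size (site_cluster V E \<omega> x\<^sub>0) = \<infinity>) = 0"
    by (rule below_Sup_threshold[OF less[unfolded site_threshold_def]])
  have p0: "0 \<le> p" "p < 1" "0 < p'" using assms(6) p' by auto
  have "tight p' x\<^sub>0"
    using p'(3) by (intro tight_if_not_percolating[OF p0(3) p'(2) assms(5)]) (simp add: infinite_iff)
  obtain T where T: "finite T" "T \<subseteq> V" "\<forall>x\<in>V. \<exists>y\<in>T. \<exists>\<gamma>\<in>graph_aut V E. x = \<gamma> y"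
    using assms(4) by (auto simp: quasi_transitive_def)
  have conn: "(x\<^sub>0, y) \<in> (\<Union>v\<in>V. site_step E v)\<^sup>*" if "y \<in> V" for y
    using that assms(3,5) by (simp add: UN_site_step[OF assms(1)] connected_graph_def)
  have orbits: "\<exists>y\<in>T. \<exists>\<gamma> \<sigma>. symmetry \<gamma> \<sigma> \<and> x = \<gamma> y" if "x \<in> V" for x
    using T(3) that symmetry_site[OF assms(1,2)] by blast
  obtain w c where wc: "0 < w" "w < 1" "0 < c"
    "\<And>x F. x \<in> V \<Longrightarrow> finite F \<Longrightarrow> F \<subseteq> V \<Longrightarrow> c \<le> bern_expect p' F (\<lambda>A. w ^ card (reach (site_step E) A {x}))"
    "\<And>x n. x \<in> V \<Longrightarrow> \<P>(\<omega> in percolation_measure V p. enat n \<le> cluster_size (open_reach \<omega> x)) \<le> w ^ n / c"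
    using exponential_decay[OF p0(1) p'(1,2) T(1,2) orbits conn \<open>tight p' x\<^sub>0\<close>] by blast
  obtain \<alpha> where \<alpha>: "0 < \<alpha>" "\<And>n t. t \<le> w ^ n / c \<Longrightarrow> t \<le> p \<Longrightarrow> t \<le> exp (- \<alpha> * real n)"
    using uniform_rate[OF wc(1-3) p0(2)] by blast
  interpret P: prob_space "percolation_measure V p" by (rule prob_space_percolation)
  have "\<P>(\<omega> in percolation_measure V p. enat n \<le> cluster_size (site_cluster V E \<omega> x)) \<le> exp (- \<alpha> * real n)"
    if n: "1 \<le> n" and x: "x \<in> V" for n x
  proof (rule \<alpha>(2))
    have tail: "\<omega> x \<and> enat n \<le> cluster_size (open_reach \<omega> x)" if "enat n \<le> cluster_size (site_cluster V E \<omega> x)" for \<omega>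
      using that n site_cluster_eq_reach[OF assms(1) x, of \<omega>] site_cluster_closed[of \<omega> x V E]
      by (cases "\<omega> x") (auto simp: cluster_size_def)
    have "\<P>(\<omega> in percolation_measure V p. enat n \<le> cluster_size (site_cluster V E \<omega> x))
      \<le> \<P>(\<omega> in percolation_measure V p. enat n \<le> cluster_size (open_reach \<omega> x))"
      using tail by (intro P.finite_measure_mono tail_event_sets assms(6)) auto
    then show "\<P>(\<omega> in percolation_measure V p. enat n \<le> cluster_size (site_cluster V E \<omega> x)) \<le> w ^ n / c"
      using wc(5)[OF x] by (rule order_trans)
    have single: "finite {x}" "{x} \<subseteq> V" using x by auto
    have "\<P>(\<omega> in percolation_measure V p. enat n \<le> cluster_size (site_cluster V E \<omega> x))
      \<le> \<P>(\<omega> in percolation_measure V p. x \<in> {v \<in> {x}. \<omega> v})"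
      using tail prob_percolation_finite(2)[OF assms(6) single, of "\<lambda>A. x \<in> A"]
      by (intro P.finite_measure_mono) auto
    also have "\<dots> = p"
      using prob_percolation_finite(1)[OF assms(6) single, of "\<lambda>A. x \<in> A"]
      by (simp add: bern_expect_insert)
    finally show "\<P>(\<omega> in percolation_measure V p. enat n \<le> cluster_size (site_cluster V E \<omega> x)) \<le> p" .
  qed
  then show ?thesis using \<alpha>(1) by blast
qed

theorem theorem3:
  fixes V :: "'a set" and E :: "'a set set" and p :: real and x\<^sub>0 :: 'a
  assumes "simple_graph V E" and "infinite V" and "countable V"
    and "connected_graph V E" and "quasi_transitive V E"
    and "x\<^sub>0 \<in> V" and "p \<in> {0..1}"
  shows "(p < bond_threshold V E x\<^sub>0 \<longrightarrow>
           (\<exists>\<alpha>>0. \<forall>n\<ge>2. \<forall>x\<in>V.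
              \<P>(\<omega> in percolation_measure E p. cluster_size (bond_cluster V E \<omega> x) \<ge> enat n)
                \<le> exp (- \<alpha> * real n))) \<and>
         (p < site_threshold V E x\<^sub>0 \<longrightarrow>
           (\<exists>\<alpha>>0. \<forall>n\<ge>1. \<forall>x\<in>V.
              \<P>(\<omega> in percolation_measure V p. cluster_size (site_cluster V E \<omega> x) \<ge> enat n)
                \<le> exp (- \<alpha> * real n)))"
  using bond_decay[OF assms] site_decay[OF assms(1,3-7)] by blast

end
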